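(* Let $X$ be a family of homogeneous polynomial vector fields on $\mathbb S^2$ of degree $2$ having a Hopf bifurcation. Then, doing an orthogonal linear change of variables, the system associated to $X$ can be written as $$\begin{aligned}\dot x&=a_1xy+a_2y^2+a_5yz,\\ \dot y&=-a_1x^2-a_2xy+a_7xz+a_8yz,\\ \dot z&=-(a_5+a_7)xy-a_8y^2,\end{aligned}$$ with $a_1\neq 0$, $a_2(a_5+a_7)-a_1a_8\neq 0$ and $-a_5a_7<0$.
   Context: $\mathbb S^2=\{(x,y,z)\in\mathbb R^3: x^2+y^2+z^2=1\}$. A homogeneous polynomial vector field of degree $2$ on $\mathbb S^2$ is a vector field $X=(P,Q,R)$ on $\mathbb R^3$ whose components are real homogeneous polynomials of degree $2$ with $xP+yQ+zR=0$ at all points of $\mathbb S^2$; its associated system is $\dot x=P$, $\dot y=Q$, $\dot z=R$, and one studies its flow restricted to $\mathbb S^2$. The coefficients $a_i$ are real. Hopf bifurcation is meant in the sense of the Hopf Bifurcation Theorem for planar systems, applied to the planar systems induced by $X$ via central projection from the origin onto the tangent plane of $\mathbb S^2$ at the point $(0,0,-1)$. That theorem reads: suppose the analytic parametrized system $\dot w=Y(w,\mu)$, $w\in\mathbb R^2$, $\mu\in\mathbb R$, has a singular point at the origin for all $\mu$, and the eigenvalues $\lambda_1(\mu),\lambda_2(\mu)$ of the linear part at the origin are pure imaginary for $\mu=\mu_0$. If the real part of the eigenvalues, $\operatorname{Re}\lambda_1(\mu)=\operatorname{Re}\lambda_2(\mu)$ in a neighbourhood of $\mu_0$, satisfies $\frac{d}{d\mu}\operatorname{Re}\lambda_1(\mu)|_{\mu=\mu_0}>0$,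 and the origin is asymptotically stable when $\mu=\mu_0$, then $\mu_0$ is a bifurcation point; for $\mu\in(\mu_1,\mu_0)$, some $\mu_1<\mu_0$, the origin is a stable focus; and for $\mu\in(\mu_0,\mu_2)$, some $\mu_2>\mu_0$, the origin is an unstable focus surrounded by a stable limit cycle whose size increases with $\mu$. *)

theory Defs
  imports "HOL-Analysis.Analysis"
begin

text \<open>
  Real analyticity: near every point the function is the sum of a power series in the coordinates.
  The multi-indices are the functions from the standard basis to the natural numbers.
\<close>

definition real_analytic :: "('a::euclidean_space \<Rightarrow> 'b::real_normed_vector) \<Rightarrow> bool" where
  "real_analytic f \<longleftrightarrow>
     (\<forall>x. \<exists>r>0. \<exists>c :: ('a \<Rightarrow> nat) \<Rightarrow> 'b. \<forall>h. norm h < r \<longrightarrow>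
        ((\<lambda>\<alpha>. (\<Prod>b\<in>Basis. (h \<bullet> b) ^ \<alpha> b) *\<^sub>R c \<alpha>) has_sum f (x + h)) (Basis \<rightarrow>\<^sub>E UNIV))"

definition homogeneous_quadratic :: "(real^3 \<Rightarrow> real) \<Rightarrow> bool" where
  "homogeneous_quadratic p \<longleftrightarrow>
     (\<exists>c :: 3 \<Rightarrow> 3 \<Rightarrow> real. \<forall>v. p v = (\<Sum>i\<in>UNIV. \<Sum>j\<in>UNIV. c i j * v $ i * v $ j))"

definition sphere_quadratic_field :: "(real^3 \<Rightarrow> real^3) \<Rightarrow> bool" where
  "sphere_quadratic_field X \<longleftrightarrow>
     (\<forall>k. homogeneous_quadratic (\<lambda>v. X v $ k)) \<and> (\<forall>v\<in>sphere 0 1. v \<bullet> X v = 0)"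

text \<open>
  The field \<open>X\<close> written in the new variables \<open>T v\<close>, for an orthogonal matrix \<open>T\<close>
  (so that the inverse of \<open>T\<close> is its transpose).
\<close>

definition change_vars :: "real^3^3 \<Rightarrow> (real^3 \<Rightarrow> real^3) \<Rightarrow> real^3 \<Rightarrow> real^3" where
  "change_vars T X v = T *v X (transpose T *v v)"

text \<open>
  Central projection from the origin onto the plane tangent to the sphere at \<open>(0,0,-1)\<close>.
  The point \<open>(u,v,-1)\<close> of that plane is identified with \<open>(u,v)\<close>. The induced planar field
  is the push-forward of the restriction of the field to the open lower hemisphere.
\<close>

definition central_projection :: "real^3 \<Rightarrow> real^2" where
  "central_projection p = vector [- p $ 1 / p $ 3, - p $ 2 / p $ 3]"

definition hemisphere_point :: "real^2 \<Rightarrow> real^3" where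
  "hemisphere_point w = sgn (vector [w $ 1, w $ 2, - 1])"

definition induced_planar_field :: "(real^3 \<Rightarrow> real^3) \<Rightarrow> real^2 \<Rightarrow> real^2" where
  "induced_planar_field X w =
     frechet_derivative central_projection (at (hemisphere_point w)) (X (hemisphere_point w))"

definition solution_on :: "real set \<Rightarrow> (real^2 \<Rightarrow> real^2) \<Rightarrow> (real \<Rightarrow> real^2) \<Rightarrow> bool" where
  "solution_on I Y w \<longleftrightarrow> (\<forall>t\<in>I. (w has_vector_derivative Y (w t)) (at t within I))"

text \<open>
  The stability clause also ranges over solutions known only on a bounded time interval, so it
  excludes escape in finite time.
\<close>

definition asymptotically_stable_origin :: "(real^2 \<Rightarrow> real^2) \<Rightarrow> bool" where
  "asymptotically_stable_origin Y \<longleftrightarrow>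
     (\<forall>\<epsilon>>0. \<exists>\<delta>>0. \<forall>w. \<forall>b\<ge>0. solution_on {0..b} Y w \<and> norm (w 0) < \<delta> \<longrightarrow>
        (\<forall>t\<in>{0..b}. norm (w t) < \<epsilon>)) \<and>
     (\<exists>\<delta>>0. \<forall>w. solution_on {0..} Y w \<and> norm (w 0) < \<delta> \<longrightarrow> (w \<longlongrightarrow> 0) at_top)"

text \<open>
  Both complex eigenvalues of a real matrix, repeated according to algebraic multiplicity.
\<close>

definition eigenvalue_pair :: "real^2^2 \<Rightarrow> complex \<Rightarrow> complex \<Rightarrow> bool" where
  "eigenvalue_pair A l1 l2 \<longleftrightarrow>
     (\<forall>z. det (mat z - (\<chi> i j. complex_of_real (A $ i $ j)) :: complex^2^2) = (z - l1) * (z - l2))"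

text \<open>
  The hypotheses of the Hopf bifurcation theorem for the family \<open>Y \<mu>\<close> at the origin and
  at the parameter value \<open>\<mu>0\<close>.
\<close>

definition planar_hopf :: "(real \<Rightarrow> real^2 \<Rightarrow> real^2) \<Rightarrow> real \<Rightarrow> bool" where
  "planar_hopf Y \<mu>0 \<longleftrightarrow>
     real_analytic (\<lambda>(w, \<mu>). Y \<mu> w) \<and>
     (\<forall>\<mu>. Y \<mu> 0 = 0) \<and>
     (\<exists>l1 l2 :: real \<Rightarrow> complex.
        (\<forall>\<mu>. eigenvalue_pair (jacobian (Y \<mu>) (at 0)) (l1 \<mu>) (l2 \<mu>)) \<and>
        Re (l1 \<mu>0) = 0 \<and> Im (l1 \<mu>0) \<noteq> 0 \<and> Re (l2 \<mu>0) = 0 \<and> Im (l2 \<mu>0) \<noteq> 0 \<and>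
        (\<forall>\<^sub>F \<mu> in nhds \<mu>0. Re (l1 \<mu>) = Re (l2 \<mu>)) \<and>
        (\<exists>d>0. ((\<lambda>\<mu>. Re (l1 \<mu>)) has_real_derivative d) (at \<mu>0))) \<and>
     asymptotically_stable_origin (Y \<mu>0)"

text \<open>
  The bifurcating singular point may be anywhere on the sphere and may move with \<open>\<mu>\<close>.
  An orthogonal change of variables depending analytically on \<open>\<mu>\<close> brings it to \<open>(0,0,-1)\<close>.
  The choice of \<open>R\<close> as the constant identity gives the case of a singular point fixed at \<open>(0,0,-1)\<close>.
\<close>

definition hopf_bifurcation_at :: "(real \<Rightarrow> real^3 \<Rightarrow> real^3) \<Rightarrow> real \<Rightarrow> bool" where
  "hopf_bifurcation_at X \<mu>0 \<longleftrightarrow>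
     (\<exists>R :: real \<Rightarrow> real^3^3. real_analytic R \<and> (\<forall>\<mu>. orthogonal_matrix (R \<mu>)) \<and>
        planar_hopf (\<lambda>\<mu>. induced_planar_field (change_vars (R \<mu>) (X \<mu>))) \<mu>0)"

definition hopf_normal_form ::
    "real \<Rightarrow> real \<Rightarrow> real \<Rightarrow> real \<Rightarrow> real \<Rightarrow> real^3 \<Rightarrow> real^3" where
  "hopf_normal_form a1 a2 a5 a7 a8 v =
     (let x = v $ 1; y = v $ 2; z = v $ 3 in
      vector [a1 * x * y + a2 * y^2 + a5 * y * z,
              - a1 * x^2 - a2 * x * y + a7 * x * z + a8 * y * z,
              - (a5 + a7) * x * y - a8 * y^2])"

end

theory Submission
  imports Defs
begin

text \<open>
  Move the bifurcating singular point to the pole. A trace zero linear part can be rotated about the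
  pole so that the coefficients \<open>a3\<close> (of \<open>x z\<close> in the first component) and \<open>a8\<close> vanish at \<open>\<mu>0\<close>. If one of
  \<open>a1\<close>, \<open>a2\<close>, \<open>a5 + a7\<close> were zero there, the flow would be time-reversible or keep the height \<open>z\<close>,
  hence would not be asymptotically stable. The other two lines of singular points are then a saddle
  and a point of positive Jacobian; taking the saddle as the new pole gives the normal form, because
  the two singular points span an invariant plane. The coefficients depend continuously on \<open>\<mu>\<close>, a small
  further rotation keeps \<open>a3 = 0\<close> near \<open>\<mu>0\<close>, and the remaining conditions are open.
\<close>

section \<open>Analytic preliminaries\<close>

text \<open>Picard iteration on the whole half-line at once: the weight \<open>exp (- K * t)\<close>
  turns the integral operator into a contraction of the space of bounded continuous functions.
  Boundedness of \<open>F\<close> makes the iterates grow at most linearly, so the weighted ones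
  stay bounded.\<close>

lemma bounded_Lipschitz_global_solution:
  fixes F :: "'a::euclidean_space \<Rightarrow> 'a"
  assumes L: "\<And>x y. norm (F x - F y) \<le> L * norm (x - y)" and B: "\<And>x. norm (F x) \<le> B"
  shows "\<exists>v. v 0 = x0 \<and> (\<forall>t\<ge>0. (v has_vector_derivative F (v t)) (at t within {0..}))"
proof -
  define M where "M = max L 1"
  \<comment> \<open>With rate \<open>2 * M\<close>, the integral of \<open>M * exp (K * r)\<close>
    over \<open>{0..s}\<close> is at most \<open>exp (K * s) / 2\<close>, whence the contraction
    factor 1/2.\<close>
  define K where "K = 2 * M"
  have M: "M > 0" "norm (F x - F y) \<le> M * norm (x - y)" for x y
    using L[of x y] mult_right_mono[of L M "norm (x - y)"] by (auto simp: M_def)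
  then have K: "K > 0" by (simp add: K_def)
  have F_cont: "continuous_on UNIV F"
    using M by (intro lipschitz_on_continuous_on[of M])
      (auto intro!: lipschitz_onI simp: dist_norm)
  define G where "G u s = F (exp (K * s) *\<^sub>R apply_bcontfun u s)" for u :: "real \<Rightarrow>\<^sub>C 'a" and s
  have G_cont: "continuous_on S (G u)" for u S
    unfolding G_def by (intro continuous_intros continuous_on_compose2[OF F_cont]) auto
  have G_int: "G u integrable_on {a..b}" for u a b
    by (intro integrable_continuous_real G_cont)
  define V where "V u t = x0 + integral {0..t} (G u)" for u t
  have V_deriv: "(V u has_vector_derivative G u t) (at t within {0..})" if "t \<ge> 0" for u t
  proof -
    have "((\<lambda>s. integral {0..s} (G u)) has_vector_derivative G u t) (at t within {0..t+1})"
      using that by (intro integral_has_vector_derivative G_cont) auto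
    moreover have "at t within {0..t+1} = at t within {0..}"
      by (rule at_within_nhd[of _ "{..<t+1}"]) auto
    ultimately show ?thesis
      unfolding V_def by (auto intro!: derivative_eq_intros)
  qed
  have V_cont: "continuous_on {0..} (V u)" for u
    unfolding continuous_on_eq_continuous_within
    by (auto intro!: has_vector_derivative_continuous V_deriv)
  have V_bound: "norm (V u t) \<le> norm x0 + B * t" if "t \<ge> 0" for u t
  proof -
    have "norm (integral {0..t} (G u)) \<le> integral {0..t} (\<lambda>s. B)"
      by (intro integral_norm_bound_integral G_int) (auto simp: G_def B)
    then show ?thesis
      using that norm_triangle_ineq[of x0 "integral {0..t} (G u)"] by (simp add: V_def mult.commute)
  qed
  \<comment> \<open>The fixed point is the weighted solution. Bounded continuous functions live on
    the whole line, so \<open>max t 0\<close> extends the iterates by a constant to negative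
    times.\<close>
  define \<Phi> where "\<Phi> u t = exp (- K * max t 0) *\<^sub>R V u (max t 0)" for u t
  have B0: "B \<ge> 0" using B[of 0] norm_ge_zero[of "F 0"] by linarith
  have \<Phi>_bcont: "\<Phi> u \<in> bcontfun" for u
    unfolding bcontfun_def bounded_iff mem_Collect_eq
  proof (intro conjI exI ballI)
    show "continuous_on UNIV (\<Phi> u)"
      unfolding \<Phi>_def by (intro continuous_intros continuous_on_compose2[OF V_cont]) auto
    fix y assume "y \<in> range (\<Phi> u)"
    then obtain t where y: "y = \<Phi> u t" by blast
    show "norm y \<le> norm x0 + B / K"
    proof -
      define s where "s = max t 0"
      have s: "s \<ge> 0" by (simp add: s_def)
      have "K * s \<le> exp (K * s)" using exp_ge_add_one_self[of "K * s"] by linarith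
      then have "B * s \<le> exp (K * s) * (B / K)"
        using K B0 mult_left_mono[of "K * s" "exp (K * s)" "B / K"] by (simp add: field_simps)
      moreover have "norm x0 \<le> exp (K * s) * norm x0"
        using K s mult_right_mono[of 1 "exp (K * s)" "norm x0"] by simp
      ultimately have "norm (V u s) \<le> exp (K * s) * (norm x0 + B / K)"
        using V_bound[OF s, of u] by (simp add: distrib_left)
      then show ?thesis
        by (simp add: y \<Phi>_def s_def[symmetric] exp_minus divide_simps mult.commute)
    qed
  qed
  have contraction: "dist (Bcontfun (\<Phi> u)) (Bcontfun (\<Phi> u')) \<le> 1/2 * dist u u'" for u u'
  proof (rule dist_bound)
    fix t :: real
    define s where "s = max t 0"
    have s: "s \<ge> 0" by (simp add: s_def)
    have exp_int: "((\<lambda>r. M * exp (K * r) * dist u u') has_integral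
        (1/2) * exp (K * s) * dist u u' - (1/2) * exp (K * 0) * dist u u') {0..s}"
      using s K unfolding has_real_derivative_iff_has_vector_derivative[symmetric]
      by (intro fundamental_theorem_of_calculus)
        (auto intro!: derivative_eq_intros simp: K_def has_real_derivative_iff_has_vector_derivative[symmetric])
    have "norm (V u s - V u' s) = norm (integral {0..s} (\<lambda>r. G u r - G u' r))"
      by (simp add: V_def integral_diff G_int)
    also have "\<dots> \<le> integral {0..s} (\<lambda>r. M * exp (K * r) * dist u u')"
    proof (intro integral_norm_bound_integral integrable_diff G_int has_integral_integrable[OF exp_int])
      fix r
      have "norm (G u r - G u' r) \<le> M * norm (exp (K * r) *\<^sub>R (u r - u' r))"
        using M(2)[of "exp (K * r) *\<^sub>R u r" "exp (K * r) *\<^sub>R u' r"]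
        by (simp add: G_def scaleR_diff_right)
      also have "\<dots> \<le> M * (exp (K * r) * dist u u')"
        using M(1) dist_bounded[of u r u'] by (simp add: dist_norm)
      finally show "norm (G u r - G u' r) \<le> M * exp (K * r) * dist u u'" by (simp add: mult.assoc)
    qed
    also have "\<dots> \<le> (1/2) * exp (K * s) * dist u u'"
      using integral_unique[OF exp_int] by simp
    finally have "norm (V u s - V u' s) \<le> exp (K * s) * (1/2 * dist u u')" by simp
    then have "norm (exp (- K * s) *\<^sub>R (V u s - V u' s)) \<le> 1/2 * dist u u'"
      by (simp add: exp_minus divide_simps mult.commute)
    then show "dist (Bcontfun (\<Phi> u) t) (Bcontfun (\<Phi> u') t) \<le> 1/2 * dist u u'"
      by (simp add: Bcontfun_inverse[OF \<Phi>_bcont] dist_norm \<Phi>_def s_def scaleR_diff_right)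
  qed
  obtain u where u: "Bcontfun (\<Phi> u) = u"
    using banach_fix_type[of "1/2" "\<lambda>u. Bcontfun (\<Phi> u)"] contraction by auto
  then have u_eq: "u t = \<Phi> u t" for t by (metis Bcontfun_inverse \<Phi>_bcont)
  have "G u t = F (V u t)" if "t \<ge> 0" for t
    using that by (simp add: G_def u_eq[of t] \<Phi>_def exp_minus)
  then show ?thesis
    using V_deriv[of _ u] by (intro exI[of _ "V u"]) (auto simp: V_def)
qed

text \<open>Inside the ball of convergence lies a point \<open>x + e\<close> with all coordinates of
  \<open>e\<close> equal to \<open>d\<close>. In absolute value, a nonconstant monomial at
  \<open>h\<close> is at most \<open>norm h / d\<close> times the same monomial at \<open>e\<close>,
  so the increment of \<open>f\<close> is bounded by a multiple of \<open>norm h\<close>.\<close>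

lemma real_analytic_isCont:
  fixes f :: "'a::euclidean_space \<Rightarrow> 'b::euclidean_space"
  assumes "real_analytic f"
  shows "isCont f x"
proof -
  let ?I = "Basis \<rightarrow>\<^sub>E UNIV :: ('a \<Rightarrow> nat) set"
  let ?m = "\<lambda>h \<alpha>. \<Prod>b\<in>Basis. (h \<bullet> b) ^ \<alpha> b :: real"
  obtain r c where r: "r > 0"
    and sm: "\<And>h. norm h < r \<Longrightarrow> ((\<lambda>\<alpha>. ?m h \<alpha> *\<^sub>R c \<alpha>) has_sum f (x + h)) ?I"
    using assms unfolding real_analytic_def by metis
  \<comment> \<open>Chosen so that \<open>norm e\<close>, which is at most
    \<open>DIM('a) * d\<close>, stays below \<open>r\<close>.\<close>
  define d where "d = r / (2 * (DIM('a) + 1))"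
  define e where "e = (\<Sum>b\<in>Basis. d *\<^sub>R b :: 'a)"
  have d: "d > 0" using r by (simp add: d_def)
  have "norm e \<le> (\<Sum>b\<in>(Basis::'a set). norm (d *\<^sub>R b))" unfolding e_def by (rule norm_sum)
  also have "\<dots> = DIM('a) * d" using d by simp
  also have "\<dots> < r" using r by (simp add: d_def divide_simps)
  finally have "norm e < r" .
  have e_inner: "e \<bullet> b = d" if "b \<in> Basis" for b
    unfolding e_def using that by simp
  have m_bound: "\<bar>?m h \<alpha> - ?m 0 \<alpha>\<bar> \<le> t * ?m e \<alpha>"
    if \<alpha>: "\<alpha> \<in> ?I" and t: "0 \<le> t" "t \<le> 1" and h: "\<And>b. b \<in> Basis \<Longrightarrow> \<bar>h \<bullet> b\<bar> \<le> t * d"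
    for h \<alpha> t
  proof (cases "\<forall>b\<in>Basis. \<alpha> b = 0")
    case True
    then show ?thesis using t by simp
  next
    case False
    then obtain b0 where b0: "b0 \<in> Basis" "\<alpha> b0 \<noteq> 0" by blast
    then have m0: "?m 0 \<alpha> = 0" by (auto intro!: prod_zero bexI[of _ b0])
    \<comment> \<open>One coordinate with a positive exponent contributes a factor at most
      \<open>t\<close>; the others contribute at most 1.\<close>
    have "(\<Prod>b\<in>(Basis::'a set). t ^ \<alpha> b) = t ^ \<alpha> b0 * (\<Prod>b\<in>Basis - {b0}. t ^ \<alpha> b)"
      using b0 by (simp add: prod.remove)
    also have "\<dots> \<le> t * 1"
    proof (intro mult_mono)
      show "t ^ \<alpha> b0 \<le> t" using power_decreasing[of 1 "\<alpha> b0" t] b0 t by simp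
      show "(\<Prod>b\<in>Basis - {b0}. t ^ \<alpha> b) \<le> 1" using t by (intro prod_le_1) (auto simp: power_le_one)
    qed (use t in \<open>auto intro!: prod_nonneg\<close>)
    finally have t_prod: "(\<Prod>b\<in>(Basis::'a set). t ^ \<alpha> b) \<le> t" by simp
    have "\<bar>?m h \<alpha> - ?m 0 \<alpha>\<bar> = (\<Prod>b\<in>Basis. \<bar>h \<bullet> b\<bar> ^ \<alpha> b)"
      unfolding m0 by (simp only: diff_zero abs_prod power_abs)
    also have "\<dots> \<le> (\<Prod>b\<in>Basis. (t * d) ^ \<alpha> b)"
      by (intro prod_mono conjI power_mono h) auto
    also have "\<dots> = (\<Prod>b\<in>(Basis::'a set). t ^ \<alpha> b) * ?m e \<alpha>"
      by (simp add: power_mult_distrib prod.distrib e_inner)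
    also have "\<dots> \<le> t * ?m e \<alpha>"
      using d t_prod by (intro mult_right_mono prod_nonneg) (auto simp: e_inner)
    finally show ?thesis .
  qed
  \<comment> \<open>For real series unordered summability is absolute summability; the scalar
    components make this available for the majorant at \<open>e\<close>.\<close>
  have "isCont (\<lambda>y. f y \<bullet> k) x" for k
  proof -
    define c' where "c' \<alpha> = c \<alpha> \<bullet> k" for \<alpha>
    have sm': "((\<lambda>\<alpha>. ?m h \<alpha> * c' \<alpha>) has_sum f (x + h) \<bullet> k) ?I" if "norm h < r" for h
      using has_sum_bounded_linear[OF bounded_linear_inner_left sm[OF that], of k] by (simp add: c'_def)
    have "(\<lambda>\<alpha>. \<bar>?m e \<alpha> * c' \<alpha>\<bar>) summable_on ?I"
      using sm'[OF \<open>norm e < r\<close>] summable_on_iff_abs_summable_on_real[of "\<lambda>\<alpha>. ?m e \<alpha> * c' \<alpha>" ?I]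
      by (auto simp: summable_on_def)
    then obtain A where A: "((\<lambda>\<alpha>. \<bar>?m e \<alpha> * c' \<alpha>\<bar>) has_sum A) ?I"
      by (auto simp: summable_on_def)
    have bound: "\<bar>f (x + h) \<bullet> k - f x \<bullet> k\<bar> \<le> norm h / d * A" if h: "norm h < min r d" for h
    proof -
      define t where "t = norm h / d"
      have t: "0 \<le> t" "t \<le> 1" "t * d = norm h" using d h by (auto simp: t_def)
      have D: "((\<lambda>\<alpha>. (?m h \<alpha> - ?m 0 \<alpha>) * c' \<alpha>) has_sum (f (x + h) \<bullet> k - f x \<bullet> k)) ?I"
        using has_sum_add[OF sm'[of h] has_sum_cmult_right[OF sm'[of 0], of "-1"]] h r
        by (simp add: algebra_simps)
      have T: "((\<lambda>\<alpha>. t * \<bar>?m e \<alpha> * c' \<alpha>\<bar>) has_sum t * A) ?I"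
        by (rule has_sum_cmult_right[OF A])
      have le: "\<bar>(?m h \<alpha> - ?m 0 \<alpha>) * c' \<alpha>\<bar> \<le> t * \<bar>?m e \<alpha> * c' \<alpha>\<bar>" if "\<alpha> \<in> ?I" for \<alpha>
      proof -
        have "\<bar>?m h \<alpha> - ?m 0 \<alpha>\<bar> \<le> t * ?m e \<alpha>"
          using t Basis_le_norm by (intro m_bound that) auto
        also have "\<dots> \<le> t * \<bar>?m e \<alpha>\<bar>" using t by (intro mult_left_mono) auto
        finally have "\<bar>?m h \<alpha> - ?m 0 \<alpha>\<bar> * \<bar>c' \<alpha>\<bar> \<le> t * \<bar>?m e \<alpha>\<bar> * \<bar>c' \<alpha>\<bar>"
          by (rule mult_right_mono) simp
        then show ?thesis by (simp add: abs_mult mult.assoc)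
      qed
      have "f (x + h) \<bullet> k - f x \<bullet> k \<le> t * A"
        using le by (intro has_sum_mono[OF D T]) (auto simp: abs_le_iff)
      moreover have "(-1) * (f (x + h) \<bullet> k - f x \<bullet> k) \<le> t * A"
        using le by (intro has_sum_mono[OF has_sum_cmult_right[OF D] T]) (auto simp: abs_le_iff)
      ultimately show ?thesis by (simp add: t_def)
    qed
    have "((\<lambda>h. norm h / d * A) \<longlongrightarrow> 0) (at 0)"
      using d by (auto intro!: tendsto_eq_intros)
    then have "((\<lambda>h. f (x + h) \<bullet> k - f x \<bullet> k) \<longlongrightarrow> 0) (at 0)"
    proof (rule Lim_null_comparison[rotated])
      have "min r d > 0" using r d by simp
      then show "\<forall>\<^sub>F h in at 0. norm (f (x + h) \<bullet> k - f x \<bullet> k) \<le> norm h / d * A"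
        unfolding eventually_at using bound by (auto intro!: exI[of _ "min r d"] simp: dist_norm)
    qed
    then show ?thesis
      unfolding isCont_def by (rule LIM_offset_zero_cancel[OF LIM_zero_cancel])
  qed
  then show ?thesis
    unfolding isCont_def using tendsto_componentwise_iff[of f "f x" "at x"] by blast
qed

section \<open>Quadratic fields on the sphere and their central projection\<close>

lemma homogeneous_quadratic_iff_matrix:
  "homogeneous_quadratic p \<longleftrightarrow> (\<exists>C :: real^3^3. \<forall>v. p v = v \<bullet> (C *v v))"
proof -
  have *: "(\<Sum>i\<in>UNIV. \<Sum>j\<in>UNIV. c i j * v $ i * v $ j) = v \<bullet> ((\<chi> i j. c i j) *v v)"
    for c :: "3 \<Rightarrow> 3 \<Rightarrow> real" and v
    by (simp add: inner_vec_def matrix_vector_mult_def sum_distrib_left mult_ac)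
  show ?thesis
  proof
    assume "homogeneous_quadratic p"
    then show "\<exists>C :: real^3^3. \<forall>v. p v = v \<bullet> (C *v v)"
      unfolding homogeneous_quadratic_def * by blast
  next
    assume "\<exists>C :: real^3^3. \<forall>v. p v = v \<bullet> (C *v v)"
    then obtain C :: "real^3^3" where "\<And>v. p v = v \<bullet> (C *v v)" by blast
    then show "homogeneous_quadratic p"
      unfolding homogeneous_quadratic_def * by (intro exI[of _ "\<lambda>i j. C $ i $ j"]) simp
  qed
qed

lemma sphere_quadratic_field_matrices:
  assumes "sphere_quadratic_field Z"
  obtains C :: "3 \<Rightarrow> real^3^3" where "\<And>k v. Z v $ k = v \<bullet> (C k *v v)"
  using assms unfolding sphere_quadratic_field_def homogeneous_quadratic_iff_matrix by metis

lemma sphere_quadratic_field_scaleR: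
  assumes "sphere_quadratic_field Z"
  shows "Z (r *\<^sub>R v) = r\<^sup>2 *\<^sub>R Z v"
proof -
  obtain C :: "3 \<Rightarrow> real^3^3" where "\<And>k v. Z v $ k = v \<bullet> (C k *v v)"
    using sphere_quadratic_field_matrices[OF assms] by blast
  then show ?thesis
    by (simp add: vec_eq_iff matrix_vector_mult_scaleR power2_eq_square)
qed

text \<open>By homogeneity the tangency condition spreads from the sphere to all of space, where it
  becomes an identity between cubic polynomials.\<close>

lemma sphere_quadratic_field_tangent:
  assumes "sphere_quadratic_field Z"
  shows "v \<bullet> Z v = 0"
proof (cases "v = 0")
  case False
  then have "sgn v \<bullet> Z (sgn v) = 0"
    using assms by (simp add: sphere_quadratic_field_def norm_sgn)
  then show ?thesis
    using False by (simp add: sgn_div_norm sphere_quadratic_field_scaleR[OF assms])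
qed simp

lemma inner_transpose_mult: "(transpose T *v v) \<bullet> w = v \<bullet> (T *v w)" for T :: "real^'n^'m"
  by (simp add: dot_lmul_matrix)

text \<open>Each new component combines, with the entries of a row of \<open>T\<close>, the forms
  with matrices \<open>T ** C j ** transpose T\<close>. Tangency follows by moving \<open>T\<close>
  across the inner product.\<close>

lemma change_vars_sphere_quadratic_field:
  assumes T: "orthogonal_matrix T" and Z: "sphere_quadratic_field Z"
  shows "sphere_quadratic_field (change_vars T Z)"
proof -
  obtain C :: "3 \<Rightarrow> real^3^3" where C: "\<And>k v. Z v $ k = v \<bullet> (C k *v v)"
    using sphere_quadratic_field_matrices[OF Z] by blast
  have "change_vars T Z v $ k =
      v \<bullet> ((\<Sum>j\<in>UNIV. T $ k $ j *\<^sub>R (T ** C j ** transpose T)) *v v)" for k v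
  proof -
    have "change_vars T Z v $ k = (\<Sum>j\<in>UNIV. T $ k $ j * (v \<bullet> ((T ** C j ** transpose T) *v v)))"
      by (simp only: change_vars_def matrix_vector_mult_def[of T] vec_lambda_beta C
          inner_transpose_mult matrix_vector_mul_assoc[symmetric])
    also have "\<dots> = v \<bullet> (\<Sum>j\<in>UNIV. T $ k $ j *\<^sub>R ((T ** C j ** transpose T) *v v))"
      by (simp only: inner_sum_right inner_scaleR_right)
    also have "(\<Sum>j\<in>UNIV. T $ k $ j *\<^sub>R ((T ** C j ** transpose T) *v v))
        = (\<Sum>j\<in>UNIV. T $ k $ j *\<^sub>R (T ** C j ** transpose T)) *v v"
      by (simp add: sum_3 matrix_vector_mult_add_rdistrib scaleR_matrix_vector_assoc)
    finally show ?thesis .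
  qed
  moreover have "v \<bullet> change_vars T Z v = 0" for v
    using sphere_quadratic_field_tangent[OF Z, of "transpose T *v v"]
    by (simp only: change_vars_def inner_transpose_mult)
  ultimately show ?thesis
    unfolding sphere_quadratic_field_def homogeneous_quadratic_iff_matrix by blast
qed

section \<open>Quadratic fields with a singular point at the pole\<close>

definition pole_field :: "real \<Rightarrow> real \<Rightarrow> real \<Rightarrow> real \<Rightarrow> real \<Rightarrow> real \<Rightarrow> real^3 \<Rightarrow> real^3" where
  "pole_field a1 a2 a3 a5 a7 a8 v =
     (let x = v $ 1; y = v $ 2; z = v $ 3 in
      vector [a1 * x * y + a2 * y^2 + a3 * x * z + a5 * y * z,
              - a1 * x^2 - a2 * x * y + a7 * x * z + a8 * y * z,
              - a3 * x^2 - (a5 + a7) * x * y - a8 * y^2])"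

lemma pole_field_nth:
  "pole_field a1 a2 a3 a5 a7 a8 v $ 1 = a1 * v$1 * v$2 + a2 * (v$2)^2 + a3 * v$1 * v$3 + a5 * v$2 * v$3"
  "pole_field a1 a2 a3 a5 a7 a8 v $ 2 = - a1 * (v$1)^2 - a2 * v$1 * v$2 + a7 * v$1 * v$3 + a8 * v$2 * v$3"
  "pole_field a1 a2 a3 a5 a7 a8 v $ 3 = - a3 * (v$1)^2 - (a5 + a7) * v$1 * v$2 - a8 * (v$2)^2"
  by (simp_all add: pole_field_def Let_def vector_3)

lemma hopf_normal_form_eq_pole_field:
  "hopf_normal_form a1 a2 a5 a7 a8 = pole_field a1 a2 0 a5 a7 a8"
  by (simp add: fun_eq_iff hopf_normal_form_def pole_field_def Let_def vec_eq_iff forall_3 algebra_simps)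

text \<open>The singular point kills the three coefficients of the square of z, and tangency relates
  the remaining ones by comparison of coefficients.\<close>

lemma sphere_quadratic_field_singular_at_pole:
  assumes Z: "sphere_quadratic_field Z" and pole: "Z (vector [0, 0, -1]) = 0"
  obtains a1 a2 a3 a5 a7 a8 where "Z = pole_field a1 a2 a3 a5 a7 a8"
proof -
  obtain C :: "3 \<Rightarrow> real^3^3" where C: "\<And>k v. Z v $ k = v \<bullet> (C k *v v)"
    using sphere_quadratic_field_matrices[OF Z] by blast
  define q where "q k i j = C k $ i $ j" for k i j
  have q: "Z v $ k = q k 1 1 * (v$1)^2 + q k 2 2 * (v$2)^2 + q k 3 3 * (v$3)^2
      + (q k 1 2 + q k 2 1) * v$1 * v$2 + (q k 1 3 + q k 3 1) * v$1 * v$3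
      + (q k 2 3 + q k 3 2) * v$2 * v$3" for k v
    unfolding C inner_vec_def matrix_vector_mult_def sum_3 q_def
    by (simp add: power2_eq_square algebra_simps)
  have tangent: "v$1 * Z v $ 1 + v$2 * Z v $ 2 + v$3 * Z v $ 3 = 0" for v
    using sphere_quadratic_field_tangent[OF Z, of v] by (simp add: inner_vec_def sum_3)
  have t: "x * Z (vector [x,y,z]) $ 1 + y * Z (vector [x,y,z]) $ 2 + z * Z (vector [x,y,z]) $ 3 = 0" for x y z
    using tangent[of "vector [x,y,z]"] by (simp add: vector_3)
  \<comment> \<open>The values at these ten points determine the ten coefficients of the cubic
    polynomial given by tangency.\<close>
  note rels = t[of 1 0 0] t[of 0 1 0] t[of 0 0 1] t[of 1 1 0] t[of 1 "-1" 0] t[of 1 0 1] t[of 1 0 "-1"]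
    t[of 0 1 1] t[of 0 1 "-1"] t[of 1 1 1]
  have z: "q k 3 3 = 0" for k
    using arg_cong[OF pole, of "\<lambda>u. u $ k"] unfolding q by (simp add: vector_3)
  have r: "q 1 1 1 = 0" "q 2 2 2 = 0" "q 2 1 1 = - (q 1 1 2 + q 1 2 1)" "q 2 1 2 + q 2 2 1 = - q 1 2 2"
    "q 3 1 1 = - (q 1 1 3 + q 1 3 1)" "q 3 1 3 + q 3 3 1 = 0" "q 3 2 2 = - (q 2 2 3 + q 2 3 2)"
    "q 3 2 3 + q 3 3 2 = 0" "q 3 1 2 + q 3 2 1 = - (q 1 2 3 + q 1 3 2) - (q 2 1 3 + q 2 3 1)"
    using rels z[of 1] z[of 2] z[of 3] unfolding q by (simp_all add: vector_3)
  have "Z = pole_field (q 1 1 2 + q 1 2 1) (q 1 2 2) (q 1 1 3 + q 1 3 1) (q 1 2 3 + q 1 3 2)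
      (q 2 1 3 + q 2 3 1) (q 2 2 3 + q 2 3 2)"
    unfolding fun_eq_iff vec_eq_iff forall_3 pole_field_nth q[of _ 1] q[of _ 2] q[of _ 3] z r
    by (simp add: algebra_simps)
  then show ?thesis by (rule that)
qed

section \<open>The planar field in coordinates\<close>

lemma central_projection_has_derivative:
  assumes "p $ 3 \<noteq> 0"
  shows "(central_projection has_derivative
     (\<lambda>h. vector [- h$1 / p$3 + p$1 * h$3 / (p$3)^2, - h$2 / p$3 + p$2 * h$3 / (p$3)^2])) (at p)"
proof -
  have "((\<lambda>p. - p $ k / p $ 3) has_derivative (\<lambda>h. - h$k / p$3 + p$k * h$3 / (p$3)^2)) (at p)"
    for k :: 3
    using assms
    by (auto intro!: derivative_eq_intros bounded_linear.has_derivative[OF bounded_linear_vec_nth]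
        simp: fun_eq_iff field_simps power2_eq_square)
  then show ?thesis
    unfolding central_projection_def
    by (subst has_derivative_componentwise_within)
      (auto simp: Basis_vec_def inner_axis exhaust_2 vector_2 forall_2)
qed

text \<open>With \<open>s\<close> the norm of \<open>(w$1, w$2, -1)\<close>, moving the argument
  from the sphere to the tangent plane costs \<open>1 / s^2\<close> by homogeneity, while the
  derivative of the projection contributes \<open>s\<close>; the factor \<open>1 / s\<close>
  remains.\<close>

lemma induced_planar_field_eq:
  assumes Z: "sphere_quadratic_field Z"
  shows "induced_planar_field Z w = (1 / sqrt (1 + (w$1)^2 + (w$2)^2)) *\<^sub>R
     (let U = Z (vector [w$1, w$2, -1]) in vector [U$1 + w$1 * U$3, U$2 + w$2 * U$3])"
proof -
  define s where "s = sqrt (1 + (w$1)^2 + (w$2)^2)"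
  have s: "s > 0" unfolding s_def by (simp add: add_pos_nonneg)
  define p :: "real^3" where "p = vector [w$1, w$2, -1]"
  have "norm p = s" by (simp add: norm_vec_def L2_set_def sum_3 p_def vector_3 s_def ac_simps)
  then have h: "hemisphere_point w = (1 / s) *\<^sub>R p"
    unfolding hemisphere_point_def sgn_div_norm p_def[symmetric] by (simp add: divide_inverse)
  have p3: "((1 / s) *\<^sub>R p) $ 3 = - 1 / s" by (simp add: p_def vector_3)
  then have "frechet_derivative central_projection (at ((1 / s) *\<^sub>R p)) =
     (\<lambda>h. vector [- h$1 / (- 1 / s) + ((1 / s) *\<^sub>R p)$1 * h$3 / (- 1 / s)^2,
       - h$2 / (- 1 / s) + ((1 / s) *\<^sub>R p)$2 * h$3 / (- 1 / s)^2])"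
    using s by (intro frechet_derivative_at[symmetric])
      (use central_projection_has_derivative[of "(1 / s) *\<^sub>R p"] in simp)
  then show ?thesis
    unfolding induced_planar_field_def h sphere_quadratic_field_scaleR[OF Z] s_def[symmetric]
      p_def[symmetric] Let_def
    using s by (simp add: vec_eq_iff forall_2 vector_2 p_def vector_3 field_simps power2_eq_square)
qed

section \<open>Reversible singular points\<close>

lemma sphere_quadratic_field_Lipschitz:
  assumes Z: "sphere_quadratic_field Z"
  obtains L where "\<And>v w. norm v \<le> 1 \<Longrightarrow> norm w \<le> 1 \<Longrightarrow> norm (Z v - Z w) \<le> L * norm (v - w)"
proof -
  obtain C :: "3 \<Rightarrow> real^3^3" where C: "\<And>k v. Z v $ k = v \<bullet> (C k *v v)"
    using sphere_quadratic_field_matrices[OF Z] by blast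
  define N where "N k = onorm ((*v) (C k))" for k
  have N: "norm (C k *v x) \<le> N k * norm x" for k x
    unfolding N_def by (rule onorm[OF matrix_vector_mul_bounded_linear])
  have N0: "N k \<ge> 0" for k
    unfolding N_def by (rule onorm_pos_le[OF matrix_vector_mul_bounded_linear])
  have "norm (Z v - Z w) \<le> (\<Sum>k\<in>UNIV. 2 * N k) * norm (v - w)" if vw: "norm v \<le> 1" "norm w \<le> 1" for v w
  proof -
    have "\<bar>(Z v - Z w) $ k\<bar> \<le> 2 * N k * norm (v - w)" for k
    proof -
      have "(Z v - Z w) $ k = (v - w) \<bullet> (C k *v v) + w \<bullet> (C k *v (v - w))"
        by (simp add: C inner_diff_left inner_diff_right matrix_vector_mult_diff_distrib)
      also have "\<bar>\<dots>\<bar> \<le> norm (v - w) * (N k * norm v) + norm w * (N k * norm (v - w))"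
        by (intro order_trans[OF abs_triangle_ineq] add_mono order_trans[OF Cauchy_Schwarz_ineq2]
            mult_left_mono N norm_ge_zero)
      also have "\<dots> \<le> norm (v - w) * (N k * 1) + 1 * (N k * norm (v - w))"
        using vw N0 by (intro add_mono mult_left_mono mult_right_mono) auto
      finally show ?thesis by simp
    qed
    then have "(\<Sum>k\<in>UNIV. \<bar>(Z v - Z w) $ k\<bar>) \<le> (\<Sum>k\<in>UNIV. 2 * N k * norm (v - w))"
      by (intro sum_mono)
    then show ?thesis
      using norm_le_l1_cart[of "Z v - Z w"] by (simp only: sum_distrib_right)
  qed
  then show ?thesis by (rule that)
qed

text \<open>
  The field composed with the nearest-point retraction onto the unit ball is bounded and Lipschitz,
  and its solutions keep their norm, since the retraction moves points radially.
\<close>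

lemma sphere_quadratic_field_global_solution:
  assumes Z: "sphere_quadratic_field Z" and x0: "norm x0 = 1"
  obtains v where "v 0 = x0" "\<And>t. t \<ge> 0 \<Longrightarrow> norm (v t) = 1"
    "\<And>t. t \<ge> 0 \<Longrightarrow> (v has_vector_derivative Z (v t)) (at t within {0..})"
proof -
  define \<pi> where "\<pi> = closest_point (cball 0 1 :: (real^3) set)"
  have \<pi>_norm: "norm (\<pi> x) \<le> 1" for x
    using closest_point_in_set[of "cball 0 1" x] by (simp add: \<pi>_def)
  have \<pi>_lip: "norm (\<pi> x - \<pi> y) \<le> norm (x - y)" for x y
    using closest_point_lipschitz[of "cball 0 1" x y] by (simp add: \<pi>_def dist_norm)
  have \<pi>_id: "\<pi> x = x" if "norm x \<le> 1" for x
    using that by (simp add: \<pi>_def closest_point_self)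
  have \<pi>_radial: "x \<bullet> Z (\<pi> x) = 0" for x
  proof (cases "norm x \<le> 1")
    case True
    then show ?thesis by (simp add: \<pi>_id sphere_quadratic_field_tangent[OF Z])
  next
    case False
    have "sgn x = \<pi> x"
      unfolding \<pi>_def
    proof (rule closest_point_unique)
      have "x \<noteq> 0" using False by (metis norm_zero zero_le_one)
      show "sgn x \<in> cball 0 1" by (simp add: norm_sgn)
      show "\<forall>z\<in>cball 0 1. dist x (sgn x) \<le> dist x z"
      proof
        fix z :: "real^3" assume "z \<in> cball 0 1"
        have "x - sgn x = (1 - 1 / norm x) *\<^sub>R x"
          by (simp add: sgn_div_norm scaleR_diff_left divide_inverse)
        then have "dist x (sgn x) = \<bar>1 - 1 / norm x\<bar> * norm x" by (simp add: dist_norm)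
        also have "\<bar>1 - 1 / norm x\<bar> = 1 - 1 / norm x"
          using False \<open>x \<noteq> 0\<close> by (simp add: abs_of_nonneg divide_le_eq)
        also have "(1 - 1 / norm x) * norm x = norm x - 1"
          using \<open>x \<noteq> 0\<close> by (simp add: left_diff_distrib)
        also have "\<dots> \<le> dist x z"
          using \<open>z \<in> cball 0 1\<close> norm_triangle_ineq2[of x z] by (simp add: dist_norm)
        finally show "dist x (sgn x) \<le> dist x z" .
      qed
    qed auto
    then show ?thesis
      using sphere_quadratic_field_tangent[OF Z, of x]
      by (metis inner_scaleR_right mult_zero_right sgn_div_norm sphere_quadratic_field_scaleR[OF Z])
  qed
  obtain L where L: "\<And>v w. norm v \<le> 1 \<Longrightarrow> norm w \<le> 1 \<Longrightarrow> norm (Z v - Z w) \<le> L * norm (v - w)"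
    using sphere_quadratic_field_Lipschitz[OF Z] by blast
  have L0: "L \<ge> 0" using order_trans[OF norm_ge_zero L[of "axis 1 1" 0]]
    by (simp add: norm_Basis axis_in_Basis_iff)
  have "norm (Z (\<pi> x) - Z (\<pi> y)) \<le> L * norm (x - y)" for x y
    using L[OF \<pi>_norm \<pi>_norm, of x y] mult_left_mono[OF \<pi>_lip L0] by (rule order_trans)
  moreover have "norm (Z (\<pi> x)) \<le> L" for x
  proof -
    have "Z 0 = 0" using sphere_quadratic_field_scaleR[OF Z, of 0 0] by simp
    then show ?thesis using L[OF \<pi>_norm, of 0 x] mult_left_mono[OF \<pi>_norm L0, of x] by simp
  qed
  ultimately obtain v where v0: "v 0 = x0"
    and v: "\<And>t. t \<ge> 0 \<Longrightarrow> (v has_vector_derivative Z (\<pi> (v t))) (at t within {0..})"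
    using bounded_Lipschitz_global_solution[of "\<lambda>x. Z (\<pi> x)" L L x0] by auto
  have norm_v: "norm (v t) = 1" if "t \<ge> 0" for t
  proof -
    have "\<exists>c. \<forall>s\<in>{0..}. v s \<bullet> v s = c"
    proof (rule has_vector_derivative_zero_constant)
      show "((\<lambda>s. v s \<bullet> v s) has_vector_derivative 0) (at s within {0..})" if "s \<in> {0..}" for s
        using has_derivative_inner[OF v[unfolded has_vector_derivative_def] v[unfolded has_vector_derivative_def], of s] that
        by (simp add: has_vector_derivative_def \<pi>_radial inner_commute[of _ "v s"])
    qed auto
    then have "v t \<bullet> v t = v 0 \<bullet> v 0" using that by auto
    then show ?thesis using x0 by (simp add: v0 norm_eq_sqrt_inner)
  qed
  show ?thesis
  proof (rule that)
    show "(v has_vector_derivative Z (v t)) (at t within {0..})" if "t \<ge> 0" for t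
      using v[OF that] norm_v[OF that] by (simp add: \<pi>_id)
  qed (use v0 norm_v in auto)
qed

text \<open>The planar distance from the origin depends on the height alone, so stability can be
  read off from the third coordinate.\<close>

lemma norm_central_projection:
  assumes "norm p = 1" "p $ 3 < 0"
  shows "(norm (central_projection p))^2 = 1 / (p $ 3)^2 - 1"
proof -
  have "(p$1)^2 + (p$2)^2 = 1 - (p$3)^2"
    using assms(1) by (simp add: norm_vec_def L2_set_def sum_3)
  moreover have "(norm (central_projection p))^2 = ((p$1)^2 + (p$2)^2) / (p$3)^2"
    unfolding power2_norm_eq_inner
    by (simp add: inner_vec_def sum_2 central_projection_def power2_eq_square add_divide_distrib)
  ultimately show ?thesis
    using assms(2) by (simp add: diff_divide_distrib)
qed

lemma hemisphere_point_central_projection: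
  assumes "norm p = 1" "p $ 3 < 0"
  shows "hemisphere_point (central_projection p) = p"
proof -
  have "vector [central_projection p $ 1, central_projection p $ 2, -1] = (- 1 / p $ 3) *\<^sub>R p"
    using assms by (simp add: central_projection_def vec_eq_iff forall_3)
  then show ?thesis
    using assms by (simp add: hemisphere_point_def sgn_scaleR sgn_div_norm)
qed

lemma hemisphere_point:
  "norm (hemisphere_point w) = 1" "hemisphere_point w $ 3 < 0"
  "central_projection (hemisphere_point w) = w"
proof -
  define p :: "real^3" where "p = vector [w$1, w$2, -1]"
  have p: "p \<noteq> 0" by (auto simp: p_def vec_eq_iff forall_3)
  have h: "hemisphere_point w = (1 / norm p) *\<^sub>R p"
    by (simp add: hemisphere_point_def sgn_div_norm p_def divide_inverse)
  show "norm (hemisphere_point w) = 1" "hemisphere_point w $ 3 < 0"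
    using p by (simp_all add: h) (simp add: p_def)
  show "central_projection (hemisphere_point w) = w"
    using p by (simp add: h central_projection_def vec_eq_iff forall_2) (simp add: p_def)
qed

lemma central_projection_solution:
  assumes "\<And>t. t \<in> I \<Longrightarrow> norm (v t) = 1" "\<And>t. t \<in> I \<Longrightarrow> v t $ 3 < 0"
    and "\<And>t. t \<in> I \<Longrightarrow> (v has_vector_derivative Z (v t)) (at t within I)"
  shows "solution_on I (induced_planar_field Z) (\<lambda>t. central_projection (v t))"
  unfolding solution_on_def
proof
  fix t assume t: "t \<in> I"
  let ?D = "frechet_derivative central_projection (at (v t))"
  have "(central_projection has_derivative ?D) (at (v t))"
    using central_projection_has_derivative[of "v t"] assms(2)[OF t]
    by (auto simp: frechet_derivative_works[symmetric] differentiable_def)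
  then have "((\<lambda>t. central_projection (v t)) has_vector_derivative ?D (Z (v t))) (at t within I)"
    by (rule vector_derivative_diff_chain_within[OF assms(3)[OF t] has_derivative_at_withinI,
        unfolded o_def])
  then show "((\<lambda>t. central_projection (v t)) has_vector_derivative
      induced_planar_field Z (central_projection (v t))) (at t within I)"
    by (simp add: induced_planar_field_def hemisphere_point_central_projection assms t)
qed

text \<open>Solutions on the sphere are global but might leave the lower hemisphere, where the chart
  ends. Stability over bounded time intervals excludes this. The outcome is a nonzero planar
  solution tending to the origin, against which irreversibility is tested.\<close>

lemma asymptotically_stable_hemisphere_solutions:
  assumes Z: "sphere_quadratic_field Z"
    and stable: "asymptotically_stable_origin (induced_planar_field Z)"
  obtains v where "\<And>t. t \<ge> 0 \<Longrightarrow> norm (v t) = 1" "\<And>t. t \<ge> 0 \<Longrightarrow> v t $ 3 < 0"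
    "\<And>t. t \<ge> 0 \<Longrightarrow> (v has_vector_derivative Z (v t)) (at t within {0..})"
    "central_projection (v 0) \<noteq> 0" "((\<lambda>t. central_projection (v t)) \<longlongrightarrow> 0) at_top"
proof -
  let ?Y = "induced_planar_field Z"
  obtain d1 where d1: "d1 > 0" "\<And>w b t. \<lbrakk>b \<ge> 0; solution_on {0..b} ?Y w; norm (w 0) < d1; t \<in> {0..b}\<rbrakk>
      \<Longrightarrow> norm (w t) < 1"
    using stable unfolding asymptotically_stable_origin_def by (metis zero_less_one)
  obtain d2 where d2: "d2 > 0" "\<And>w. \<lbrakk>solution_on {0..} ?Y w; norm (w 0) < d2\<rbrakk> \<Longrightarrow> (w \<longlongrightarrow> 0) at_top"
    using stable unfolding asymptotically_stable_origin_def by metis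
  define w0 :: "real^2" where "w0 = (min d1 d2 / 2) *\<^sub>R axis 1 1"
  have w0: "w0 \<noteq> 0" "norm w0 < d1" "norm w0 < d2"
    using d1 d2 by (auto simp: w0_def axis_eq_0_iff norm_Basis axis_in_Basis_iff)
  obtain v where v: "v 0 = hemisphere_point w0" "\<And>t. t \<ge> 0 \<Longrightarrow> norm (v t) = 1"
    "\<And>t. t \<ge> 0 \<Longrightarrow> (v has_vector_derivative Z (v t)) (at t within {0..})"
    using sphere_quadratic_field_global_solution[OF Z hemisphere_point(1)] by metis
  have v0: "central_projection (v 0) = w0" by (simp add: v hemisphere_point)
  have cont: "continuous_on {0..} (\<lambda>t. v t $ 3)"
    unfolding continuous_on_eq_continuous_within
    by (auto intro: continuous_component has_vector_derivative_continuous[OF v(3)])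
  \<comment> \<open>Planar norm below 1 forces the squared height above 1/2. The level -1/2 is
    therefore a barrier that is never touched while the solution stays in the chart.\<close>
  have small: "v b $ 3 < - 1 / 2" if b: "b \<ge> 0" "\<And>t. t \<in> {0..b} \<Longrightarrow> v t $ 3 < 0" for b
  proof -
    have "solution_on {0..b} ?Y (\<lambda>t. central_projection (v t))"
      using b v(2) by (intro central_projection_solution has_vector_derivative_within_subset[OF v(3)]) auto
    then have "norm (central_projection (v b)) < 1"
      using b w0 by (intro d1(2)[of b "\<lambda>t. central_projection (v t)"]) (auto simp: v0)
    then have "(norm (central_projection (v b)))^2 < 1"
      by (simp add: power_less_one_iff abs_square_less_1)
    then have "1 / (v b $ 3)^2 < 2"
      using norm_central_projection[of "v b"] b v by auto
    moreover have "v b $ 3 < 0" using b by auto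
    ultimately have "1 < 2 * (v b $ 3)^2" by (simp add: field_simps)
    then have "(1/2)^2 < (- v b $ 3)^2" by (simp add: power2_eq_square)
    then show ?thesis using \<open>v b $ 3 < 0\<close> power2_less_imp_less[of "1/2" "- v b $ 3"] by simp
  qed
  have v3: "v T $ 3 < 0" if T: "T \<ge> 0" for T
  proof (rule ccontr)
    assume "\<not> v T $ 3 < 0"
    \<comment> \<open>If the solution left the hemisphere it would cross the barrier; at the first
      crossing time \<open>b\<close> the chart is still valid on \<open>{0..b}\<close>, which
      contradicts \<open>small\<close>.\<close>
    define S where "S = {0..T} \<inter> (\<lambda>t. v t $ 3) -` {- 1 / 2}"
    have v03: "v 0 $ 3 < - 1 / 2"
      using hemisphere_point(2)[of w0] by (intro small) (auto simp: v)
    have "\<exists>t\<ge>0. t \<le> T \<and> v t $ 3 = - 1 / 2"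
      using v03 \<open>\<not> v T $ 3 < 0\<close> T by (intro IVT' continuous_on_subset[OF cont]) auto
    then have "S \<noteq> {}" by (auto simp: S_def)
    moreover have "compact S"
      unfolding S_def compact_eq_bounded_closed
      by (intro conjI continuous_closed_preimage continuous_on_subset[OF cont])
        (auto intro: bounded_subset[OF bounded_closed_interval])
    ultimately obtain b where b: "b \<in> S" "\<And>y. y \<in> S \<Longrightarrow> b \<le> y"
      using compact_attains_inf by metis
    have "v b $ 3 < - 1 / 2"
    proof (rule small)
      show "b \<ge> 0" using b by (auto simp: S_def)
      fix t assume t: "t \<in> {0..b}"
      show "v t $ 3 < 0"
      proof (rule ccontr)
        assume "\<not> v t $ 3 < 0"
        then have "\<exists>s\<ge>0. s \<le> t \<and> v s $ 3 = - 1 / 2"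
          using v03 t by (intro IVT' continuous_on_subset[OF cont]) auto
        then obtain s where s: "0 \<le> s" "s \<le> t" "v s $ 3 = - 1 / 2" by blast
        then have "s \<in> S" using t b by (auto simp: S_def)
        then have "s = t" using b(2)[of s] s t by auto
        then show False using s \<open>\<not> v t $ 3 < 0\<close> by simp
      qed
    qed
    then show False using b by (auto simp: S_def)
  qed
  have "solution_on {0..} ?Y (\<lambda>t. central_projection (v t))"
    using v v3 by (intro central_projection_solution) auto
  then have "((\<lambda>t. central_projection (v t)) \<longlongrightarrow> 0) at_top"
    using w0 by (intro d2) (auto simp: v0)
  then show ?thesis using v v3 v0 w0 by (intro that[of v]) auto
qed

text \<open>
  A solution tending to the singular point, run backwards and reflected, is a solution that starts
  arbitrarily close to the singular point but does not stay close to it.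
\<close>

lemma reversible_not_asymptotically_stable:
  assumes Z: "sphere_quadratic_field Z"
    and S: "orthogonal_matrix S" "\<And>v. (S *v v) $ 3 = v $ 3"
    and reverse: "\<And>v. Z (S *v v) = - (S *v Z v)"
  shows "\<not> asymptotically_stable_origin (induced_planar_field Z)"
proof
  let ?Y = "induced_planar_field Z"
  assume stable: "asymptotically_stable_origin ?Y"
  obtain v where v: "\<And>t. t \<ge> 0 \<Longrightarrow> norm (v t) = 1" "\<And>t. t \<ge> 0 \<Longrightarrow> v t $ 3 < 0"
    "\<And>t. t \<ge> 0 \<Longrightarrow> (v has_vector_derivative Z (v t)) (at t within {0..})"
    "central_projection (v 0) \<noteq> 0" "((\<lambda>t. central_projection (v t)) \<longlongrightarrow> 0) at_top"
    using asymptotically_stable_hemisphere_solutions[OF Z stable] by blast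
  have norm_S: "norm (S *v p) = norm p" for p
    using S(1) by (simp add: orthogonal_transformation_matrix orthogonal_transformation_norm)
  have proj_S: "norm (central_projection (S *v p)) = norm (central_projection p)"
    if "norm p = 1" "p $ 3 < 0" for p
    using norm_central_projection[OF that] norm_central_projection[of "S *v p"] that
    by (metis S(2) norm_S norm_ge_zero power2_eq_imp_eq)
  \<comment> \<open>The reversed solution ends at the reflection of \<open>v 0\<close>, at distance
    exactly \<open>\<epsilon>\<close> from the origin, so the strict bound from stability
    fails.\<close>
  define \<epsilon> where "\<epsilon> = norm (central_projection (v 0))"
  have "\<epsilon> > 0" using v by (simp add: \<epsilon>_def)
  then obtain \<delta> where \<delta>: "\<delta> > 0" "\<And>w b t. \<lbrakk>b \<ge> 0; solution_on {0..b} ?Y w; norm (w 0) < \<delta>; t \<in> {0..b}\<rbrakk>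
      \<Longrightarrow> norm (w t) < \<epsilon>"
    using stable unfolding asymptotically_stable_origin_def by metis
  have "\<forall>\<^sub>F t in at_top. norm (central_projection (v t)) < \<delta> \<and> t \<ge> 0"
    using tendstoD[OF v(5) \<delta>(1)] eventually_ge_at_top[of 0] by eventually_elim auto
  then obtain T where T: "norm (central_projection (v T)) < \<delta>" "T \<ge> 0"
    by (auto simp: eventually_at_top_linorder)
  define u where "u t = S *v v (T - t)" for t
  have u: "norm (u t) = 1" "u t $ 3 < 0" if "t \<in> {0..T}" for t
    using that v by (auto simp: u_def norm_S S)
  have "(u has_vector_derivative Z (u t)) (at t within {0..T})" if t: "t \<in> {0..T}" for t
  proof -
    have "(v has_vector_derivative Z (v (T - t))) (at (T - t) within (\<lambda>t. T - t) ` {0..T})"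
      using t by (intro has_vector_derivative_within_subset[OF v(3)]) auto
    then have "((v \<circ> (\<lambda>t. T - t)) has_vector_derivative (- 1) *\<^sub>R Z (v (T - t))) (at t within {0..T})"
      by (intro vector_diff_chain_within) (auto intro!: derivative_eq_intros)
    from bounded_linear.has_vector_derivative[OF matrix_vector_mul_bounded_linear this, of S]
    show ?thesis
      by (simp add: u_def[abs_def] o_def reverse linear_neg[OF matrix_vector_mul_linear])
  qed
  then have "solution_on {0..T} ?Y (\<lambda>t. central_projection (u t))"
    using u by (intro central_projection_solution) auto
  then have "norm (central_projection (u T)) < \<epsilon>"
    using T v by (intro \<delta>(2)[of T "\<lambda>t. central_projection (u t)"]) (auto simp: u_def proj_S)
  then show False using T v by (simp add: u_def proj_S \<epsilon>_def)
qed

text \<open>The height is a first integral, so a planar solution keeps its positive norm and cannot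
  tend to the origin.\<close>

lemma horizontal_not_asymptotically_stable:
  assumes Z: "sphere_quadratic_field Z" and Z3: "\<And>v. Z v $ 3 = 0"
  shows "\<not> asymptotically_stable_origin (induced_planar_field Z)"
proof
  assume stable: "asymptotically_stable_origin (induced_planar_field Z)"
  obtain v where v: "\<And>t. t \<ge> 0 \<Longrightarrow> norm (v t) = 1" "\<And>t. t \<ge> 0 \<Longrightarrow> v t $ 3 < 0"
    "\<And>t. t \<ge> 0 \<Longrightarrow> (v has_vector_derivative Z (v t)) (at t within {0..})"
    "central_projection (v 0) \<noteq> 0" "((\<lambda>t. central_projection (v t)) \<longlongrightarrow> 0) at_top"
    using asymptotically_stable_hemisphere_solutions[OF Z stable] by blast
  have "\<exists>c. \<forall>t\<in>{0..}. v t $ 3 = c"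
  proof (rule has_vector_derivative_zero_constant)
    show "((\<lambda>t. v t $ 3) has_vector_derivative 0) (at t within {0..})" if "t \<in> {0..}" for t
      using bounded_linear.has_vector_derivative[OF bounded_linear_vec_nth v(3), of t 3] that
      by (simp add: Z3)
  qed auto
  then have v3: "v t $ 3 = v 0 $ 3" if "t \<ge> 0" for t using that by auto
  have "norm (central_projection (v t)) = norm (central_projection (v 0))" if "t \<ge> 0" for t
    using norm_central_projection[of "v t"] norm_central_projection[of "v 0"] v that v3[OF that]
    by (metis norm_ge_zero order_refl power2_eq_imp_eq)
  then have "\<forall>\<^sub>F t in at_top. norm (central_projection (v t)) = norm (central_projection (v 0))"
    using eventually_ge_at_top[of 0] by (rule eventually_mono[rotated])
  then have "((\<lambda>t. norm (central_projection (v t))) \<longlongrightarrow> norm (central_projection (v 0))) at_top"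
    by (rule tendsto_eventually)
  then show False
    using tendsto_norm[OF v(5)] v(4) tendsto_unique[OF trivial_limit_at_top_linorder] by fastforce
qed

section \<open>Rotations of a field with a singular point at the pole\<close>

lemma change_vars_mul: "change_vars A (change_vars B X) = change_vars (A ** B) X"
  by (simp only: fun_eq_iff change_vars_def matrix_vector_mul_assoc[symmetric] matrix_transpose_mul) simp

text \<open>The rotations take a pair \<open>c\<close>, \<open>s\<close> in place of an angle, so
  that all identities are polynomial modulo \<open>c^2 + s^2 = 1\<close>.\<close>

definition rotz :: "real \<Rightarrow> real \<Rightarrow> real^3^3" where
  "rotz c s = vector [vector [c, - s, 0], vector [s, c, 0], vector [0, 0, 1]]"

definition roty :: "real \<Rightarrow> real \<Rightarrow> real^3^3" where
  "roty c s = vector [vector [c, 0, - s], vector [0, 1, 0], vector [s, 0, c]]"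

lemma orthogonal_rotz: "c^2 + s^2 = 1 \<Longrightarrow> orthogonal_matrix (rotz c s)"
  and orthogonal_roty: "c^2 + s^2 = 1 \<Longrightarrow> orthogonal_matrix (roty c s)"
  by (simp_all add: orthogonal_matrix rotz_def roty_def vec_eq_iff forall_3 matrix_matrix_mult_def
      sum_3 transpose_def mat_def power2_eq_square algebra_simps)

text \<open>The four functions \<open>rot3\<close>, \<open>rot5\<close>, \<open>rot7\<close>,
  \<open>rot8\<close> are the entries of the matrix with rows \<open>(a3, a5)\<close> and
  \<open>(a7, a8)\<close> conjugated by the planar rotation.\<close>

definition rot3 :: "real \<Rightarrow> real \<Rightarrow> real \<Rightarrow> real \<Rightarrow> real \<Rightarrow> real \<Rightarrow> real" where
  "rot3 c s a3 a5 a7 a8 = c^2 * a3 - c * s * (a5 + a7) + s^2 * a8"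
definition rot5 :: "real \<Rightarrow> real \<Rightarrow> real \<Rightarrow> real \<Rightarrow> real \<Rightarrow> real \<Rightarrow> real" where
  "rot5 c s a3 a5 a7 a8 = c^2 * a5 - s^2 * a7 + c * s * (a3 - a8)"
definition rot7 :: "real \<Rightarrow> real \<Rightarrow> real \<Rightarrow> real \<Rightarrow> real \<Rightarrow> real \<Rightarrow> real" where
  "rot7 c s a3 a5 a7 a8 = c^2 * a7 - s^2 * a5 + c * s * (a3 - a8)"
definition rot8 :: "real \<Rightarrow> real \<Rightarrow> real \<Rightarrow> real \<Rightarrow> real \<Rightarrow> real \<Rightarrow> real" where
  "rot8 c s a3 a5 a7 a8 = s^2 * a3 + c * s * (a5 + a7) + c^2 * a8"

lemmas rot_defs = rot3_def rot5_def rot7_def rot8_def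

lemma rotz_mult:
  "rotz c s *v u = vector [c * u$1 - s * u$2, s * u$1 + c * u$2, u$3]"
  "transpose (rotz c s) *v u = vector [c * u$1 + s * u$2, c * u$2 - s * u$1, u$3]"
  by (simp_all add: vec_eq_iff forall_3 matrix_vector_mult_def sum_3 transpose_def rotz_def)

lemma roty_mult:
  "roty c s *v u = vector [c * u$1 - s * u$3, u$2, s * u$1 + c * u$3]"
  "transpose (roty c s) *v u = vector [c * u$1 + s * u$3, u$2, c * u$3 - s * u$1]"
  by (simp_all add: vec_eq_iff forall_3 matrix_vector_mult_def sum_3 transpose_def roty_def)

lemma change_vars_rotz_pole_field:
  assumes "c^2 + s^2 = 1"
  shows "change_vars (rotz c s) (pole_field a1 a2 a3 a5 a7 a8) =
     pole_field (c * a1 - s * a2) (s * a1 + c * a2) (rot3 c s a3 a5 a7 a8) (rot5 c s a3 a5 a7 a8)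
       (rot7 c s a3 a5 a7 a8) (rot8 c s a3 a5 a7 a8)" (is "?L = ?R")
proof
  fix v :: "real^3"
  define x y z where xyz: "x = v$1" "y = v$2" "z = v$3"
  let ?l = "(c * a1 - s * a2) * x + (s * a1 + c * a2) * y"
  \<comment> \<open>The factor \<open>c^2 + s^2\<close> is kept visible so that the hypothesis can
    be applied by rewriting.\<close>
  have 1: "?L v $ 1 = (c^2 + s^2) * ?l * y + rot3 c s a3 a5 a7 a8 * x * z + rot5 c s a3 a5 a7 a8 * y * z"
    unfolding change_vars_def rotz_mult pole_field_nth vector_3 xyz[symmetric] rot_defs
    by (simp add: algebra_simps power2_eq_square)
  have 2: "?L v $ 2 = - (c^2 + s^2) * ?l * x + rot7 c s a3 a5 a7 a8 * x * z + rot8 c s a3 a5 a7 a8 * y * z"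
    unfolding change_vars_def rotz_mult pole_field_nth vector_3 xyz[symmetric] rot_defs
    by (simp add: algebra_simps power2_eq_square)
  have 3: "?L v $ 3 = ?R v $ 3"
    unfolding change_vars_def rotz_mult pole_field_nth vector_3 xyz[symmetric] rot_defs
    by (simp add: algebra_simps power2_eq_square)
  show "?L v = ?R v"
    unfolding vec_eq_iff forall_3 1 2 3 assms pole_field_nth xyz
    by (simp add: algebra_simps power2_eq_square)
qed

text \<open>Since \<open>a3 = 0\<close>, the first and third components carry the factor y, which a
  rotation about the y-axis preserves. Writing \<open>(a1, a7)\<close> as \<open>n\<close> times
  \<open>(c, s)\<close>, the line through \<open>(s, 0, c)\<close> is singular, and the rotation
  carries it to the z-axis.\<close>

lemma change_vars_roty_pole_field:
  assumes "c^2 + s^2 = 1"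
  shows "change_vars (roty c s) (pole_field (n * c) a2 0 a5 (n * s) a8) =
     pole_field (n * c) (c * a2 + s * a8) 0 (a5 + n * s) (- n * s) (c * a8 - s * a2)" (is "?L = ?R")
proof
  fix v :: "real^3"
  define x y z where xyz: "x = v$1" "y = v$2" "z = v$3"
  have 1: "?L v $ 1 = (c^2 + s^2) * (n * (c * x + s * z) + a5 * z) * y + (c * a2 + s * a8) * y^2"
    unfolding change_vars_def roty_mult pole_field_nth vector_3 xyz[symmetric]
    by (simp add: algebra_simps power2_eq_square)
  have 2: "?L v $ 2 = - (c^2 + s^2) * n * (c * x + s * z) * x + (a8 * (c * z - s * x) - a2 * (c * x + s * z)) * y"
    unfolding change_vars_def roty_mult pole_field_nth vector_3 xyz[symmetric]
    by (simp add: algebra_simps power2_eq_square)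
  have 3: "?L v $ 3 = - (c^2 + s^2) * a5 * x * y - (c * a8 - s * a2) * y^2"
    unfolding change_vars_def roty_mult pole_field_nth vector_3 xyz[symmetric]
    by (simp add: algebra_simps power2_eq_square)
  show "?L v = ?R v"
    unfolding vec_eq_iff forall_3 1 2 3 assms pole_field_nth xyz
    by (simp add: algebra_simps power2_eq_square)
qed

text \<open>
  The bifurcating focus cannot serve as the pole of the normal form, because there
  \<open>a5 a7 < 0\<close>. The line through \<open>(a7, 0, a1)\<close> consists of singular points as well, it is a saddle
  if \<open>a7 (a5 + a7) < 0\<close>, and moving it to the pole gives a normal form with \<open>a5 a7 > 0\<close>.
\<close>

lemma normal_form_at_saddle:
  assumes "a1 \<noteq> 0" "a7 * (a5 + a7) < 0" "a5 * (a1 * a2 + a7 * a8) - a1 * (a1 * a8 - a2 * a7) \<noteq> 0"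
  shows "\<exists>(T :: real^3^3) b1 b2 b5 b7 b8. orthogonal_matrix T \<and>
    change_vars T (pole_field a1 a2 0 a5 a7 a8) = hopf_normal_form b1 b2 b5 b7 b8 \<and>
    b1 \<noteq> 0 \<and> b2 * (b5 + b7) - b1 * b8 \<noteq> 0 \<and> - b5 * b7 < 0"
proof -
  \<comment> \<open>Polar coordinates of \<open>(a1, a7)\<close> put the field in the shape required
    by \<open>change_vars_roty_pole_field\<close>.\<close>
  define n c s where "n = sqrt (a1^2 + a7^2)" and "c = a1 / n" and "s = a7 / n"
  have n: "n > 0" using assms(1) by (simp add: n_def add_pos_nonneg)
  then have a: "n * c = a1" "n * s = a7" by (simp_all add: c_def s_def)
  have "n^2 = a1^2 + a7^2" by (simp add: n_def)
  then have cs: "c^2 + s^2 = 1"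
    using n assms(1) by (simp add: c_def s_def power_divide add_divide_distrib[symmetric])
  \<comment> \<open>The third hypothesis is \<open>n\<close> times the nondegeneracy expression of
    the new coefficients, whose fifth and seventh entries add up to \<open>a5\<close>.\<close>
  have "(c * a2 + s * a8) * a5 - a1 * (c * a8 - s * a2)
      = (a5 * (a1 * a2 + a7 * a8) - a1 * (a1 * a8 - a2 * a7)) / n"
    using n by (simp add: c_def s_def field_simps)
  then have "(c * a2 + s * a8) * ((a5 + a7) + (- a7)) - a1 * (c * a8 - s * a2) \<noteq> 0"
    using assms(3) n by simp
  moreover have "change_vars (roty c s) (pole_field a1 a2 0 a5 a7 a8) =
      hopf_normal_form a1 (c * a2 + s * a8) (a5 + a7) (- a7) (c * a8 - s * a2)"
    using change_vars_roty_pole_field[OF cs, of n a2 a5 a8]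
    by (simp add: a hopf_normal_form_eq_pole_field)
  moreover have "- (a5 + a7) * (- a7) < 0" using assms(2) by (simp add: algebra_simps)
  ultimately show ?thesis using orthogonal_roty[OF cs] assms(1) by blast
qed

section \<open>The linear part and nondegeneracy at the Hopf point\<close>

lemma induced_pole_field_jacobian:
  assumes "sphere_quadratic_field (pole_field a1 a2 a3 a5 a7 a8)"
  shows "jacobian (induced_planar_field (pole_field a1 a2 a3 a5 a7 a8)) (at 0) =
    vector [vector [- a3, - a5], vector [- a7, - a8]]"
proof -
  let ?Y = "induced_planar_field (pole_field a1 a2 a3 a5 a7 a8)"
  \<comment> \<open>Only the terms containing z are linear on the plane z = -1, where they change
    sign. The factor with the square root equals 1 at the origin, and its derivative multiplies a
    vanishing field.\<close>
  let ?D = "\<lambda>h :: real^2. vector [- a3 * h$1 - a5 * h$2, - a7 * h$1 - a8 * h$2] :: real^2"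
  note nth = bounded_linear.has_derivative[OF bounded_linear_vec_nth]
  have "((\<lambda>w. ?Y w $ 1) has_derivative (\<lambda>h. ?D h $ 1)) (at 0)"
    unfolding induced_planar_field_eq[OF assms] Let_def pole_field_nth
    by (auto intro!: derivative_eq_intros nth)
  moreover have "((\<lambda>w. ?Y w $ 2) has_derivative (\<lambda>h. ?D h $ 2)) (at 0)"
    unfolding induced_planar_field_eq[OF assms] Let_def pole_field_nth
    by (auto intro!: derivative_eq_intros nth)
  ultimately have "(?Y has_derivative ?D) (at 0)"
    by (subst has_derivative_componentwise_within)
      (auto simp: Basis_vec_def inner_axis forall_2)
  then have "frechet_derivative ?Y (at 0) = ?D" by (rule frechet_derivative_at[symmetric])
  then show ?thesis
    by (simp add: jacobian_def matrix_def vec_eq_iff forall_2 axis_def)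
qed

text \<open>The characteristic polynomial at 0 and 1 gives determinant and trace. A real trace makes
  the imaginary parts opposite, so the determinant is the square of \<open>Im l1\<close>.\<close>

lemma imaginary_eigenvalue_pair:
  fixes A :: "real^2^2"
  assumes "eigenvalue_pair A l1 l2" "Re l1 = 0" "Im l1 \<noteq> 0" "Re l2 = 0"
  shows "A$1$1 + A$2$2 = 0" "A$1$1 * A$2$2 - A$1$2 * A$2$1 > 0"
proof -
  have *: "(z - A$1$1) * (z - A$2$2) - of_real (A$1$2) * of_real (A$2$1) = (z - l1) * (z - l2)" for z :: complex
    using assms(1) by (simp add: eigenvalue_pair_def det_2 mat_def)
  have det: "of_real (A$1$1 * A$2$2 - A$1$2 * A$2$1) = l1 * l2" using *[of 0] by simp
  have tr: "of_real (A$1$1 + A$2$2) = l1 + l2" using *[of 1] det by (simp add: algebra_simps)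
  show "A$1$1 + A$2$2 = 0" using arg_cong[OF tr, of Re] assms by simp
  have "Im l2 = - Im l1" using arg_cong[OF tr, of Im] by simp
  then have "A$1$1 * A$2$2 - A$1$2 * A$2$1 = (Im l1)^2"
    using arg_cong[OF det, of Re] assms by (simp add: power2_eq_square)
  then show "A$1$1 * A$2$2 - A$1$2 * A$2$1 > 0" using assms by simp
qed

text \<open>A reversing symmetry \<open>D\<close> found in rotated coordinates is carried back by
  conjugation, because stability is known in the original coordinates.\<close>

lemma conjugate_reversible_not_asymptotically_stable:
  assumes Z: "sphere_quadratic_field Z"
    and S: "orthogonal_matrix S" "\<And>v. (S *v v) $ 3 = v $ 3"
    and D: "orthogonal_matrix D" "\<And>v. (D *v v) $ 3 = v $ 3"
    and reverse: "\<And>v. change_vars S Z (D *v v) = - (D *v change_vars S Z v)"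
  shows "\<not> asymptotically_stable_origin (induced_planar_field Z)"
proof (rule reversible_not_asymptotically_stable[OF Z, of "transpose S ** D ** S"])
  have SS: "S *v (transpose S *v v) = v" "transpose S *v (S *v v) = v" for v
    using S(1) by (simp_all only: matrix_vector_mul_assoc orthogonal_matrix_def matrix_vector_mul_lid)
  have Z_eq: "Z (transpose S *v v) = transpose S *v change_vars S Z v" for v
    by (simp only: change_vars_def SS)
  show "orthogonal_matrix (transpose S ** D ** S)"
    using S D by (simp add: orthogonal_matrix_mul)
  have "(transpose S *v v) $ 3 = v $ 3" for v
    using S(2)[of "transpose S *v v"] by (simp only: SS)
  then show "((transpose S ** D ** S) *v v) $ 3 = v $ 3" for v
    by (simp only: matrix_vector_mul_assoc[symmetric] S D)
  show "Z ((transpose S ** D ** S) *v v) = - ((transpose S ** D ** S) *v Z v)" for v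
    by (simp only: matrix_vector_mul_assoc[symmetric] Z_eq reverse)
      (simp only: change_vars_def SS linear_neg[OF matrix_vector_mul_linear])
qed

text \<open>If \<open>a1 = 0\<close> the reflection of x reverses the rotated field, if
  \<open>a2 = 0\<close> the reflection of y does, and if \<open>a5 + a7 = 0\<close> the height is
  conserved.\<close>

lemma asymptotically_stable_imp_nonzero:
  assumes Z: "sphere_quadratic_field Z" and cs: "c^2 + s^2 = 1"
    and stable: "asymptotically_stable_origin (induced_planar_field Z)"
    and rot: "change_vars (rotz c s) Z = pole_field a1 a2 0 a5 a7 0"
  shows "a1 \<noteq> 0" "a2 \<noteq> 0" "a5 + a7 \<noteq> 0"
proof -
  have S: "orthogonal_matrix (rotz c s)" "(rotz c s *v v) $ 3 = v $ 3" for v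
    using orthogonal_rotz[OF cs] by (simp_all add: rotz_mult)
  \<comment> \<open>\<open>D 1\<close> reflects y and \<open>D (- 1)\<close> reflects x.\<close>
  define D :: "real \<Rightarrow> real^3^3" where
    "D e = vector [vector [e, 0, 0], vector [0, - e, 0], vector [0, 0, 1]]" for e
  have D_mult: "D e *v v = vector [e * v$1, - e * v$2, v$3]" for e v
    by (simp add: vec_eq_iff forall_3 matrix_vector_mult_def sum_3 D_def)
  have D: "orthogonal_matrix (D e)" "(D e *v v) $ 3 = v $ 3" if "e * e = 1" for e v
    using that by (simp_all add: orthogonal_matrix vec_eq_iff forall_3 matrix_matrix_mult_def
        matrix_vector_mult_def sum_3 transpose_def mat_def D_def)
  note irreversible = conjugate_reversible_not_asymptotically_stable[OF Z S D, unfolded rot]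
  show "a1 \<noteq> 0"
  proof
    assume "a1 = 0"
    then show False
      using irreversible[of "- 1"] stable
      by (simp add: D_mult vec_eq_iff forall_3 pole_field_nth)
  qed
  show "a2 \<noteq> 0"
  proof
    assume "a2 = 0"
    then show False
      using irreversible[of 1] stable
      by (simp add: D_mult vec_eq_iff forall_3 pole_field_nth)
  qed
  show "a5 + a7 \<noteq> 0"
  proof
    assume "a5 + a7 = 0"
    have "Z v $ 3 = 0" for v
    proof -
      have "change_vars (rotz c s) Z (rotz c s *v v) $ 3 = Z v $ 3"
        using S(1) by (simp only: change_vars_def S(2) matrix_vector_mul_assoc orthogonal_matrix_def
            matrix_vector_mul_lid)
      then show ?thesis by (simp add: rot pole_field_nth \<open>a5 + a7 = 0\<close>)
    qed
    then show False using horizontal_not_asymptotically_stable[OF Z] stable by blast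
  qed
qed

text \<open>A trace zero matrix can be rotated to zero diagonal, in two ways that differ by a
  quarter turn. The quarter turn replaces the off-diagonal pair \<open>(p, q)\<close> by
  \<open>(-q, -p)\<close>, and since \<open>p * q < 0\<close> one of the two satisfies the saddle
  condition.\<close>

lemma rotation_of_hopf_point:
  assumes Z: "sphere_quadratic_field (pole_field a1 a2 a3 a5 a7 a8)"
    and stable: "asymptotically_stable_origin (induced_planar_field (pole_field a1 a2 a3 a5 a7 a8))"
    and tr: "a3 + a8 = 0" and det: "a3 * a8 - a5 * a7 > 0"
  obtains c s where "c^2 + s^2 = 1" "rot3 c s a3 a5 a7 a8 = 0" "rot8 c s a3 a5 a7 a8 = 0"
    "c * a1 - s * a2 \<noteq> 0" "s * a1 + c * a2 \<noteq> 0"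
    "rot7 c s a3 a5 a7 a8 * (rot5 c s a3 a5 a7 a8 + rot7 c s a3 a5 a7 a8) < 0"
proof -
  \<comment> \<open>The angle \<open>\<phi>\<close> belongs to the symmetric part of the linear
    part; under conjugation this part turns by twice the rotation angle, hence
    \<open>\<phi> / 2\<close>.\<close>
  obtain r \<phi> where r: "(a5 + a7) / 2 = r * cos \<phi>" "a3 = r * sin \<phi>"
    using polar_Ex by blast
  define c s where "c = cos (\<phi> / 2)" and "s = sin (\<phi> / 2)"
  have cs: "c^2 + s^2 = 1" by (simp add: c_def s_def)
  have a8: "a8 = - a3" using tr by simp
  have "sin \<phi> = 2 * s * c" "cos \<phi> = c^2 - s^2"
    using sin_double[of "\<phi> / 2"] cos_double[of "\<phi> / 2"] by (simp_all add: c_def s_def)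
  then have "a3 = r * (2 * s * c)" "a5 + a7 = 2 * r * (c^2 - s^2)" using r by simp_all
  moreover have "rot3 c s a3 a5 a7 a8 = (c^2 - s^2) * a3 - c * s * (a5 + a7)"
    by (simp add: rot3_def a8 algebra_simps)
  ultimately have r3: "rot3 c s a3 a5 a7 a8 = 0" by simp
  have "rot3 c s a3 a5 a7 a8 + rot8 c s a3 a5 a7 a8 = (c^2 + s^2) * (a3 + a8)"
    by (simp add: rot3_def rot8_def algebra_simps)
  then have r8: "rot8 c s a3 a5 a7 a8 = 0" using r3 tr by simp
  let ?p = "rot5 c s a3 a5 a7 a8" and ?q = "rot7 c s a3 a5 a7 a8"
  \<comment> \<open>The determinant is invariant under the rotation.\<close>
  have "rot3 c s a3 a5 a7 a8 * rot8 c s a3 a5 a7 a8 - ?p * ?q = (c^2 + s^2)^2 * (a3 * a8 - a5 * a7)"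
    unfolding rot_defs by (simp add: algebra_simps power2_eq_square)
  then have pq: "?p * ?q < 0" using det by (simp add: r3 r8 cs)
  have nz: "c * a1 - s * a2 \<noteq> 0" "s * a1 + c * a2 \<noteq> 0" "?p + ?q \<noteq> 0"
    by (rule asymptotically_stable_imp_nonzero[OF Z cs stable
        change_vars_rotz_pole_field[OF cs, of a1 a2 a3 a5 a7 a8, unfolded r3 r8]])+
  show ?thesis
  proof (cases "?q * (?p + ?q) < 0")
    case True
    then show ?thesis using cs r3 r8 nz by (intro that[of c s])
  next
    case False
    have "(?q * (?p + ?q)) * (?p * (?p + ?q)) = (?p * ?q) * (?p + ?q)^2"
      by (simp add: power2_eq_square)
    also have "\<dots> < 0" using pq nz by (simp add: mult_less_0_iff)
    finally have "?p * (?p + ?q) < 0"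
      using False mult_less_0_iff[of "?q * (?p + ?q)" "?p * (?p + ?q)"] by linarith
    moreover have "rot5 (- s) c a3 a5 a7 a8 = - ?q" "rot7 (- s) c a3 a5 a7 a8 = - ?p"
      "rot3 (- s) c a3 a5 a7 a8 = rot8 c s a3 a5 a7 a8" "rot8 (- s) c a3 a5 a7 a8 = rot3 c s a3 a5 a7 a8"
      by (simp_all add: rot_defs algebra_simps)
    ultimately show ?thesis
      using cs r3 r8 nz by (intro that[of "- s" c]) (simp_all add: algebra_simps)
  qed
qed

text \<open>Divided by \<open>c^2\<close>, the equation \<open>rot3 = 0\<close> is the quadratic
  \<open>b3 - k * \<tau> + b8 * \<tau>^2 = 0\<close> in \<open>\<tau> = s / c\<close>. The root is
  written with the radical in the denominator, so it makes sense for \<open>b8 = 0\<close> and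
  vanishes together with \<open>b3\<close>.\<close>

lemma rot3_root:
  assumes "k = b5 + b7" "k \<noteq> 0" "4 * b3 * b8 / k^2 \<le> 1"
    and "\<tau> = 2 * b3 / (k * (1 + sqrt (1 - 4 * b3 * b8 / k^2)))"
  shows "rot3 (1 / sqrt (1 + \<tau>^2)) (\<tau> / sqrt (1 + \<tau>^2)) b3 b5 b7 b8 = 0"
proof -
  \<comment> \<open>A square root of the discriminant, zero or of the same sign as \<open>k\<close>,
    so that \<open>k + D\<close> cannot vanish.\<close>
  define D where "D = k * sqrt (1 - 4 * b3 * b8 / k^2)"
  have "1 + sqrt (1 - 4 * b3 * b8 / k^2) > 0"
    using assms(3) by (simp add: add_pos_nonneg)
  then have kD: "k + D \<noteq> 0" and \<tau>: "\<tau> = 2 * b3 / (k + D)"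
    using assms(2,4) by (simp_all add: D_def algebra_simps) (metis distrib_left mult.right_neutral mult_eq_0_iff order_less_irrefl)
  have D: "D^2 = k^2 - 4 * b3 * b8"
    using assms(2,3) by (simp add: D_def power_mult_distrib right_diff_distrib)
  have "\<tau> * (k + D) = 2 * b3" using kD by (simp add: \<tau>)
  moreover have "(b3 - \<tau> * k + \<tau>^2 * b8) * (k + D)^2
      = b3 * (k + D)^2 - (\<tau> * (k + D)) * k * (k + D) + (\<tau> * (k + D))^2 * b8"
    by (simp add: power2_eq_square algebra_simps)
  ultimately have "(b3 - \<tau> * k + \<tau>^2 * b8) * (k + D)^2 = b3 * (4 * b3 * b8 + D^2 - k^2)"
    by (simp add: power2_eq_square algebra_simps)
  then have "b3 - \<tau> * k + \<tau>^2 * b8 = 0" using kD by (simp add: D)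
  moreover have "(sqrt (1 + \<tau>^2))^2 = 1 + \<tau>^2" by simp
  ultimately show ?thesis
    unfolding rot3_def assms(1)[symmetric]
    by (simp add: power_divide power2_eq_square[symmetric] add_divide_distrib[symmetric] diff_divide_distrib[symmetric])
qed

lemma isCont_eventually:
  fixes f :: "real \<Rightarrow> real"
  assumes "isCont f x"
  shows "f x \<noteq> 0 \<Longrightarrow> \<forall>\<^sub>F y in nhds x. f y \<noteq> 0" "f x < a \<Longrightarrow> \<forall>\<^sub>F y in nhds x. f y < a"
proof -
  have f: "filterlim f (nhds (f x)) (nhds x)"
    using assms by (simp add: isCont_def tendsto_at_iff_tendsto_nhds)
  show "f x \<noteq> 0 \<Longrightarrow> \<forall>\<^sub>F y in nhds x. f y \<noteq> 0" by (rule tendsto_imp_eventually_ne[OF f])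
  show "f x < a \<Longrightarrow> \<forall>\<^sub>F y in nhds x. f y < a" by (rule order_tendstoD(2)[OF f])
qed

section \<open>Extension from the bifurcation value to nearby parameters\<close>

theorem theorem9:
  fixes X :: "real \<Rightarrow> real^3 \<Rightarrow> real^3" and \<mu>0 :: real
  assumes "\<And>\<mu>. sphere_quadratic_field (X \<mu>)"
    and "hopf_bifurcation_at X \<mu>0"
  shows "\<forall>\<^sub>F \<mu> in nhds \<mu>0. \<exists>(T :: real^3^3) a1 a2 a5 a7 a8.
           orthogonal_matrix T \<and>
           change_vars T (X \<mu>) = hopf_normal_form a1 a2 a5 a7 a8 \<and>
           a1 \<noteq> 0 \<and> a2 * (a5 + a7) - a1 * a8 \<noteq> 0 \<and> - a5 * a7 < 0"
proof -
  obtain R :: "real \<Rightarrow> real^3^3" where R: "\<And>\<mu>. orthogonal_matrix (R \<mu>)"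
    and hopf: "planar_hopf (\<lambda>\<mu>. induced_planar_field (change_vars (R \<mu>) (X \<mu>))) \<mu>0"
    using assms(2) unfolding hopf_bifurcation_at_def by blast
  define Z where "Z \<mu> = change_vars (R \<mu>) (X \<mu>)" for \<mu>
  define Y where "Y \<mu> = induced_planar_field (Z \<mu>)" for \<mu>
  have Z: "sphere_quadratic_field (Z \<mu>)" for \<mu>
    unfolding Z_def by (rule change_vars_sphere_quadratic_field[OF R assms(1)])
  have analytic: "real_analytic (\<lambda>(w, \<mu>). Y \<mu> w)" and Y0: "\<And>\<mu>. Y \<mu> 0 = 0"
    and stable: "asymptotically_stable_origin (Y \<mu>0)"
    using hopf unfolding planar_hopf_def Y_def Z_def by auto
  obtain l1 l2 :: complex where eig: "eigenvalue_pair (jacobian (Y \<mu>0) (at 0)) l1 l2"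
    "Re l1 = 0" "Im l1 \<noteq> 0" "Re l2 = 0"
    using hopf unfolding planar_hopf_def Y_def Z_def by blast
  have "\<exists>a1 a2 a3 a5 a7 a8. Z \<mu> = pole_field a1 a2 a3 a5 a7 a8" for \<mu>
  proof -
    \<comment> \<open>The vanishing planar field controls only the first two components at the pole;
      the third vanishes by tangency.\<close>
    define U where "U = Z \<mu> (vector [0, 0, -1])"
    have "vector [U $ 1, U $ 2] = (0 :: real^2)"
      using Y0[of \<mu>] by (simp add: Y_def induced_planar_field_eq[OF Z] U_def Let_def)
    then have "U $ 1 = 0" "U $ 2 = 0" by (simp_all add: vec_eq_iff forall_2)
    moreover have "U $ 3 = 0"
      using sphere_quadratic_field_tangent[OF Z, of "vector [0, 0, -1]" \<mu>]
      by (simp add: U_def inner_vec_def sum_3)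
    ultimately have "U = 0" by (simp add: vec_eq_iff forall_3)
    then show ?thesis
      using sphere_quadratic_field_singular_at_pole[OF Z] unfolding U_def by metis
  qed
  then obtain a1 a2 a3 a5 a7 a8 where
    Z_eq: "\<And>\<mu>. Z \<mu> = pole_field (a1 \<mu>) (a2 \<mu>) (a3 \<mu>) (a5 \<mu>) (a7 \<mu>) (a8 \<mu>)"
    by metis
  note field = Z[unfolded Z_eq]
  have Y_eq: "Y \<mu> (vector [x, y]) = (1 / sqrt (1 + x^2 + y^2)) *\<^sub>R
     (let U = pole_field (a1 \<mu>) (a2 \<mu>) (a3 \<mu>) (a5 \<mu>) (a7 \<mu>) (a8 \<mu>) (vector [x, y, -1])
      in vector [U$1 + x * U$3, U$2 + y * U$3])" for \<mu> x y
    using induced_planar_field_eq[OF Z, of \<mu> "vector [x, y]"] by (simp add: Y_def Z_eq)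
  \<comment> \<open>At the planar points \<open>(1, 0)\<close>, \<open>(-1, 0)\<close>,
    \<open>(0, 1)\<close>, \<open>(0, -1)\<close> the field carries the factor
    \<open>1 / sqrt 2\<close> and each coefficient comes out doubled; up to sign, \<open>e\<close>
    cancels both. The coefficients thus inherit continuity from the analytic planar family.\<close>
  define e where "e = - sqrt 2 / 2"
  have e2: "1 / sqrt (2 :: real) = sqrt 2 / 2" by (simp add: field_simps)
  have "isCont (\<lambda>\<mu>. case (vector [x, y], \<mu>) of (w, \<mu>) \<Rightarrow> Y \<mu> w) \<mu>" for x y \<mu>
    by (rule isCont_o2[OF _ real_analytic_isCont[OF analytic]]) (intro continuous_intros)
  then have Y_cont: "isCont (\<lambda>\<mu>. Y \<mu> (vector [x, y]) $ i) \<mu>" for x y i \<mu>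
    by (intro continuous_intros) simp
  have "a1 = (\<lambda>\<mu>. e * (Y \<mu> (vector [1, 0]) $ 2 + Y \<mu> (vector [-1, 0]) $ 2))"
    "a7 = (\<lambda>\<mu>. e * (Y \<mu> (vector [1, 0]) $ 2 - Y \<mu> (vector [-1, 0]) $ 2))"
    "a3 = (\<lambda>\<mu>. e * Y \<mu> (vector [1, 0]) $ 1)"
    "a8 = (\<lambda>\<mu>. e * Y \<mu> (vector [0, 1]) $ 2)"
    "a2 = (\<lambda>\<mu>. - e * (Y \<mu> (vector [0, 1]) $ 1 + Y \<mu> (vector [0, -1]) $ 1))"
    "a5 = (\<lambda>\<mu>. e * (Y \<mu> (vector [0, 1]) $ 1 - Y \<mu> (vector [0, -1]) $ 1))"
    unfolding Y_eq e_def by (simp_all add: fun_eq_iff pole_field_nth e2 algebra_simps) (simp_all add: field_simps)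
  then have cont: "isCont a1 \<mu>" "isCont a2 \<mu>" "isCont a3 \<mu>" "isCont a5 \<mu>" "isCont a7 \<mu>" "isCont a8 \<mu>" for \<mu>
    by (simp_all only:) (intro continuous_intros Y_cont)+

  have jac: "jacobian (Y \<mu>0) (at 0) = vector [vector [- a3 \<mu>0, - a5 \<mu>0], vector [- a7 \<mu>0, - a8 \<mu>0]]"
    unfolding Y_def Z_eq by (rule induced_pole_field_jacobian[OF field])
  have tr: "a3 \<mu>0 + a8 \<mu>0 = 0" and det: "a3 \<mu>0 * a8 \<mu>0 - a5 \<mu>0 * a7 \<mu>0 > 0"
    using imaginary_eigenvalue_pair[OF eig] unfolding jac vector_2 minus_mult_minus by linarith+
  obtain c s where cs: "c^2 + s^2 = 1" and rot: "rot3 c s (a3 \<mu>0) (a5 \<mu>0) (a7 \<mu>0) (a8 \<mu>0) = 0"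
    "rot8 c s (a3 \<mu>0) (a5 \<mu>0) (a7 \<mu>0) (a8 \<mu>0) = 0"
    "c * a1 \<mu>0 - s * a2 \<mu>0 \<noteq> 0" "s * a1 \<mu>0 + c * a2 \<mu>0 \<noteq> 0"
    "rot7 c s (a3 \<mu>0) (a5 \<mu>0) (a7 \<mu>0) (a8 \<mu>0) * (rot5 c s (a3 \<mu>0) (a5 \<mu>0) (a7 \<mu>0) (a8 \<mu>0)
       + rot7 c s (a3 \<mu>0) (a5 \<mu>0) (a7 \<mu>0) (a8 \<mu>0)) < 0"
    using rotation_of_hopf_point[OF field stable[unfolded Y_def Z_eq] tr det] by metis
  \<comment> \<open>Coefficients after a rotation fixed for all parameters; \<open>b3\<close> is
    zero at \<open>\<mu>0\<close> but possibly not nearby.\<close>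
  define b1 b2 b3 b5 b7 b8 where b_defs: "b1 \<mu> = c * a1 \<mu> - s * a2 \<mu>" "b2 \<mu> = s * a1 \<mu> + c * a2 \<mu>"
    "b3 \<mu> = rot3 c s (a3 \<mu>) (a5 \<mu>) (a7 \<mu>) (a8 \<mu>)" "b5 \<mu> = rot5 c s (a3 \<mu>) (a5 \<mu>) (a7 \<mu>) (a8 \<mu>)"
    "b7 \<mu> = rot7 c s (a3 \<mu>) (a5 \<mu>) (a7 \<mu>) (a8 \<mu>)" "b8 \<mu> = rot8 c s (a3 \<mu>) (a5 \<mu>) (a7 \<mu>) (a8 \<mu>)" for \<mu>
  have b_at: "b3 \<mu>0 = 0" "b8 \<mu>0 = 0" "b1 \<mu>0 \<noteq> 0" "b2 \<mu>0 \<noteq> 0" "b7 \<mu>0 * (b5 \<mu>0 + b7 \<mu>0) < 0"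
    using rot by (simp_all add: b_defs)
  have b_cont: "isCont b1 \<mu>" "isCont b2 \<mu>" "isCont b3 \<mu>" "isCont b5 \<mu>" "isCont b7 \<mu>" "isCont b8 \<mu>" for \<mu>
    unfolding b_defs rot_defs by (intro continuous_intros cont)+

  define k where "k \<mu> = b5 \<mu> + b7 \<mu>" for \<mu>
  \<comment> \<open>The tangent of a second rotation, varying with the parameter, that restores the
    vanishing of the third coefficient. It is continuous at \<open>\<mu>0\<close> because
    \<open>k\<close> is nonzero there, and it is the identity rotation at
    \<open>\<mu>0\<close>.\<close>
  define \<tau> where "\<tau> \<mu> = 2 * b3 \<mu> / (k \<mu> * (1 + sqrt (1 - 4 * b3 \<mu> * b8 \<mu> / (k \<mu>)^2)))" for \<mu>
  define C where "C \<mu> = 1 / sqrt (1 + (\<tau> \<mu>)^2)" for \<mu>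
  define S where "S \<mu> = \<tau> \<mu> / sqrt (1 + (\<tau> \<mu>)^2)" for \<mu>
  have k0: "k \<mu>0 \<noteq> 0" using b_at by (auto simp: k_def)
  have k_cont: "isCont k \<mu>0" unfolding k_def by (intro continuous_intros b_cont)
  have "isCont \<tau> \<mu>0"
    unfolding \<tau>_def using k0 b_at by (intro continuous_intros b_cont k_cont) auto
  moreover have \<tau>0: "\<tau> \<mu>0 = 0" by (simp add: \<tau>_def b_at)
  ultimately have CS_cont: "isCont C \<mu>0" "isCont S \<mu>0"
    unfolding C_def S_def by (intro continuous_intros; simp)+
  have CS: "(C \<mu>)^2 + (S \<mu>)^2 = 1" for \<mu>
  proof -
    have "1 + (\<tau> \<mu>)^2 > 0" by (simp add: add_pos_nonneg)
    then show ?thesis by (simp add: C_def S_def power_divide add_divide_distrib[symmetric])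
  qed
  define d1 d2 d3 d5 d7 d8 where d_defs: "d1 \<mu> = C \<mu> * b1 \<mu> - S \<mu> * b2 \<mu>" "d2 \<mu> = S \<mu> * b1 \<mu> + C \<mu> * b2 \<mu>"
    "d3 \<mu> = rot3 (C \<mu>) (S \<mu>) (b3 \<mu>) (b5 \<mu>) (b7 \<mu>) (b8 \<mu>)" "d5 \<mu> = rot5 (C \<mu>) (S \<mu>) (b3 \<mu>) (b5 \<mu>) (b7 \<mu>) (b8 \<mu>)"
    "d7 \<mu> = rot7 (C \<mu>) (S \<mu>) (b3 \<mu>) (b5 \<mu>) (b7 \<mu>) (b8 \<mu>)" "d8 \<mu> = rot8 (C \<mu>) (S \<mu>) (b3 \<mu>) (b5 \<mu>) (b7 \<mu>) (b8 \<mu>)" for \<mu>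
  have d_cont: "isCont d1 \<mu>0" "isCont d2 \<mu>0" "isCont d5 \<mu>0" "isCont d7 \<mu>0" "isCont d8 \<mu>0"
    unfolding d_defs rot_defs by (intro continuous_intros b_cont CS_cont)+
  have d_at: "d1 \<mu>0 = b1 \<mu>0" "d2 \<mu>0 = b2 \<mu>0" "d5 \<mu>0 = b5 \<mu>0" "d7 \<mu>0 = b7 \<mu>0" "d8 \<mu>0 = 0"
    by (simp_all add: d_defs rot_defs C_def S_def \<tau>0 b_at)
  have change: "change_vars (rotz (C \<mu>) (S \<mu>) ** rotz c s ** R \<mu>) (X \<mu>) =
      pole_field (d1 \<mu>) (d2 \<mu>) (d3 \<mu>) (d5 \<mu>) (d7 \<mu>) (d8 \<mu>)" for \<mu>
    unfolding change_vars_mul[symmetric] Z_def[symmetric] Z_eq change_vars_rotz_pole_field[OF cs]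
      change_vars_rotz_pole_field[OF CS] b_defs[symmetric] d_defs ..

  have "\<forall>\<^sub>F \<mu> in nhds \<mu>0. k \<mu> \<noteq> 0"
    by (rule isCont_eventually(1)[OF k_cont k0])
  moreover have "\<forall>\<^sub>F \<mu> in nhds \<mu>0. 4 * b3 \<mu> * b8 \<mu> / (k \<mu>)^2 < 1"
    by (rule isCont_eventually(2)) (use k0 b_at in \<open>auto intro!: continuous_intros b_cont k_cont\<close>)
  moreover have "\<forall>\<^sub>F \<mu> in nhds \<mu>0. d1 \<mu> \<noteq> 0"
    by (rule isCont_eventually(1)[OF d_cont(1)]) (simp add: d_at b_at)
  moreover have "\<forall>\<^sub>F \<mu> in nhds \<mu>0. d7 \<mu> * (d5 \<mu> + d7 \<mu>) < 0"
    by (rule isCont_eventually(2)) (use b_at in \<open>auto simp: d_at intro!: continuous_intros d_cont\<close>)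
  moreover have "\<forall>\<^sub>F \<mu> in nhds \<mu>0.
      d5 \<mu> * (d1 \<mu> * d2 \<mu> + d7 \<mu> * d8 \<mu>) - d1 \<mu> * (d1 \<mu> * d8 \<mu> - d2 \<mu> * d7 \<mu>) \<noteq> 0"
  proof (rule isCont_eventually(1))
    \<comment> \<open>With \<open>d8 \<mu>0 = 0\<close> the condition of
      \<open>normal_form_at_saddle\<close> factors into the three quantities that stability keeps
      away from zero.\<close>
    have "b1 \<mu>0 * b2 \<mu>0 * k \<mu>0 \<noteq> 0" using b_at k0 by simp
    then show "d5 \<mu>0 * (d1 \<mu>0 * d2 \<mu>0 + d7 \<mu>0 * d8 \<mu>0) - d1 \<mu>0 * (d1 \<mu>0 * d8 \<mu>0 - d2 \<mu>0 * d7 \<mu>0) \<noteq> 0"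
      by (simp add: d_at k_def algebra_simps)
  qed (intro continuous_intros d_cont)
  ultimately show ?thesis
  proof eventually_elim
    case (elim \<mu>)
    have "d3 \<mu> = 0"
      unfolding d_defs C_def S_def
      using elim by (intro rot3_root[of "k \<mu>"]) (auto simp: k_def \<tau>_def)
    obtain T :: "real^3^3" and e1 e2 e5 e7 e8 where T: "orthogonal_matrix T"
      "change_vars T (pole_field (d1 \<mu>) (d2 \<mu>) 0 (d5 \<mu>) (d7 \<mu>) (d8 \<mu>)) = hopf_normal_form e1 e2 e5 e7 e8"
      "e1 \<noteq> 0" "e2 * (e5 + e7) - e1 * e8 \<noteq> 0" "- e5 * e7 < 0"
      using normal_form_at_saddle[OF elim(3,4,5)] by blast
    have "orthogonal_matrix (T ** (rotz (C \<mu>) (S \<mu>) ** rotz c s ** R \<mu>))"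
      by (intro orthogonal_matrix_mul T orthogonal_rotz CS cs R)
    moreover have "change_vars (T ** (rotz (C \<mu>) (S \<mu>) ** rotz c s ** R \<mu>)) (X \<mu>) =
        hopf_normal_form e1 e2 e5 e7 e8"
      unfolding change_vars_mul[symmetric, of T] change \<open>d3 \<mu> = 0\<close> by (rule T)
    ultimately show ?case using T by blast
  qed
qed

end
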